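(* Let $s,\ell,k\ge 1$ be integers and let $p_1,\dots,p_k\ge 1$ be integers with $\sum_{i=1}^k p_i=\ell s$. Let $D$ be the ordered initial deck of $\ell s$ cards, whose first $p_1$ cards have colour $P_1$, next $p_2$ cards have colour $P_2$, ..., and last $p_k$ cards have colour $P_k$. The deck is $a$-shuffled and then dealt to $\ell$ players, $s$ cards each. Let $\kappa_{\mathrm{ord}}$, $\kappa_{\mathrm{cyc}}$, $\kappa_{\mathrm{bf}}$ denote the coefficient of $a^{-1}$ in the expansion, as $a\to\infty$, of the variation distance $\|\mathbb P_a-\Pi\|$ between the distribution of the resulting hand and the stationary distribution $\Pi$, when the dealing method is the ordered, the cyclic, and the back and forth dealing, respectively. Then: 1. $\kappa_{\mathrm{ord}}=s\cdot\kappa_{\mathrm{cyc}}$; 2. if $s$ is even, then $\kappa_{\mathrm{bf}}=0$; 3. if $s$ is odd, then $\kappa_{\mathrm{bf}}=\frac1s\,\kappa_{\mathrm{cyc}}$.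
   Context: Let $n=\ell s$. A deck is an ordered sequence of $n$ cards; cards of the same colour are indistinguishable, and all decks considered have exactly $p_i$ cards of colour $P_i$. Shuffling. For a positive integer $a$, an $a$-shuffle cuts the deck into $a$ packets of sizes $q_1,\dots,q_a$ with probability $\binom{n}{q_1,\dots,q_a}/a^n$ and then interleaves the packets, keeping the relative order inside each packet, all such interleavings being equally likely. A permutation $\pi\in S_n$ acts on a deck by moving the card in position $i$ to position $\pi(i)$. With $\mathrm{des}(\pi)=\#\{i:\pi(i)>\pi(i+1)\}$, the probability of $\pi$ under an $a$-shuffle is $$\mathbb P_a(\pi)=\frac1{a^n}\binom{a+n-\mathrm{des}(\pi)-1}{n}.$$ For decks $D,D'$, $\mathbb P_a(D\to D')=\sum_{\pi}\mathbb P_a(\pi)$, the sum being over all $\pi\in S_n$ that transform $D$ into $D'$. Dealing. A dealing method is a word of length $\ell s$ in the letters $1,\dots,\ell$ (the players), each occurring exactly $s$ times; the card in position $m$ of the shuffled deck goes to the player given by the $m$-th letter. - Ordered dealing: the first $s$ cards go to player $1$, the next $s$ cards to player $2$, ..., the last $s$ cards to player $\ell$. - Cyclic dealing: the block $1\,2\cdots\ell$ repeated $s$ times. - Back and forth dealing: $s$ consecutive blocks of length $\ell$, alternately $1\,2\cdots\ell$ and $\ell\cdots 2\,1$, starting with $1\,2\cdots\ell$ (so for odd $s$ the last block is $1\,2\cdots\ell$). Hands. The set $\Omega$ of hands consists of all families of non-negative integers $\omega=(p_{i,j})_{1\le i\le k,\,1\le j\le\ell}$ with $\sum_{i=1}^k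 p_{i,j}=s$ for every $j$ and $\sum_{j=1}^\ell p_{i,j}=p_i$ for every $i$, where $p_{i,j}$ is the number of cards of colour $P_i$ received by player $j$. The order of the cards within a player's hand is disregarded. For $\omega\in\Omega$, $\mathbb P_a(\omega)=\sum_{D'}\mathbb P_a(D\to D')$, the sum being over all decks $D'$ that give the hand $\omega$ when dealt by the given dealing method. The stationary distribution (the distribution of the hand when the deck is uniformly random) is $$\Pi(\omega)=\frac{s!^{\ell}}{(\ell s)!}\prod_{i=1}^k\frac{p_i!}{\prod_{j=1}^{\ell}p_{i,j}!},\qquad \omega\in\Omega.$$ The variation distance is $\|\mathbb P_a-\Pi\|=\frac12\sum_{\omega\in\Omega}|\mathbb P_a(\omega)-\Pi(\omega)|$. The coefficient of $a^{-1}$ for a given dealing method is the number $\kappa$ with $\|\mathbb P_a-\Pi\|=\kappa\,a^{-1}+O(a^{-2})$ as $a\to\infty$. *)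

theory Defs
  imports Complex_Main "HOL-Library.Landau_Symbols" "HOL-Combinatorics.Permutations"
begin

text \<open>
  A deck is a list of colours, a dealing word a list of players. Colours are the numbers in
  \<open>{1..k}\<close> and players the numbers in \<open>{1..l}\<close>; positions in a deck or word, and packets of a
  cut, are counted from 0, as usual for lists.
\<close>

definition decks :: "nat \<Rightarrow> (nat \<Rightarrow> nat) \<Rightarrow> nat list set" where
  "decks k p = {D. length D = (\<Sum>i\<in>{1..k}. p i) \<and> set D \<subseteq> {1..k} \<and>
                   (\<forall>i\<in>{1..k}. count_list D i = p i)}"

definition ordered_deck :: "nat \<Rightarrow> (nat \<Rightarrow> nat) \<Rightarrow> nat list" where
  "ordered_deck k p = concat (map (\<lambda>i. replicate (p i) i) [1..<Suc k])"


subsection \<open>Shuffling\<close>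

text \<open>A cut into \<open>a\<close> packets is the list of packet sizes; packets may be empty.\<close>

definition cuts :: "nat \<Rightarrow> nat \<Rightarrow> nat list set" where
  "cuts a n = {q. length q = a \<and> sum_list q = n}"

definition cut_prob :: "nat \<Rightarrow> nat \<Rightarrow> nat list \<Rightarrow> real" where
  "cut_prob a n q = (fact n / (\<Prod>x\<leftarrow>q. fact x)) / real a ^ n"

definition packet :: "nat list \<Rightarrow> nat \<Rightarrow> nat set" where
  "packet q j = {sum_list (take j q)..<sum_list (take (Suc j) q)}"

text \<open>
  A permutation \<open>\<pi>\<close> moves the card in position \<open>i\<close> to position \<open>\<pi> i\<close>, so keeping the relative
  order inside a packet means that \<open>\<pi>\<close> is increasing on the positions of that packet.
\<close>

definition interleavings :: "nat \<Rightarrow> nat list \<Rightarrow> (nat \<Rightarrow> nat) set" where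
  "interleavings n q =
     {\<pi>. \<pi> permutes {..<n} \<and> (\<forall>j<length q. strict_mono_on (packet q j) \<pi>)}"

definition shuffle_prob :: "nat \<Rightarrow> nat \<Rightarrow> (nat \<Rightarrow> nat) \<Rightarrow> real" where
  "shuffle_prob a n \<pi> =
     (\<Sum>q\<in>cuts a n. cut_prob a n q *
        (if \<pi> \<in> interleavings n q then 1 / real (card (interleavings n q)) else 0))"

definition transforms :: "(nat \<Rightarrow> nat) \<Rightarrow> nat list \<Rightarrow> nat list \<Rightarrow> bool" where
  "transforms \<pi> D D' \<longleftrightarrow> length D' = length D \<and> (\<forall>i<length D. D' ! \<pi> i = D ! i)"

definition deck_prob :: "nat \<Rightarrow> nat list \<Rightarrow> nat list \<Rightarrow> real" where
  "deck_prob a D D' =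
     (\<Sum>\<pi> | \<pi> permutes {..<length D} \<and> transforms \<pi> D D'. shuffle_prob a (length D) \<pi>)"


subsection \<open>Dealing\<close>

definition ordered_dealing :: "nat \<Rightarrow> nat \<Rightarrow> nat list" where
  "ordered_dealing s l = concat (map (\<lambda>j. replicate s j) [1..<Suc l])"

definition cyclic_dealing :: "nat \<Rightarrow> nat \<Rightarrow> nat list" where
  "cyclic_dealing s l = concat (replicate s [1..<Suc l])"

definition back_forth_dealing :: "nat \<Rightarrow> nat \<Rightarrow> nat list" where
  "back_forth_dealing s l =
     concat (map (\<lambda>b. if even b then [1..<Suc l] else rev [1..<Suc l]) [0..<s])"


subsection \<open>Hands\<close>

text \<open>\<open>\<omega> i j\<close> is the number of cards of colour \<open>i\<close> held by player \<open>j\<close>; families indexed by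
  \<open>{1..k} \<times> {1..l}\<close> are functions that vanish elsewhere.\<close>

definition hands :: "nat \<Rightarrow> nat \<Rightarrow> nat \<Rightarrow> (nat \<Rightarrow> nat) \<Rightarrow> (nat \<Rightarrow> nat \<Rightarrow> nat) set" where
  "hands s l k p =
     {\<omega>. (\<forall>i j. i \<notin> {1..k} \<or> j \<notin> {1..l} \<longrightarrow> \<omega> i j = 0) \<and>
         (\<forall>j\<in>{1..l}. (\<Sum>i\<in>{1..k}. \<omega> i j) = s) \<and>
         (\<forall>i\<in>{1..k}. (\<Sum>j\<in>{1..l}. \<omega> i j) = p i)}"

definition deal :: "nat list \<Rightarrow> nat list \<Rightarrow> nat \<Rightarrow> nat \<Rightarrow> nat" where
  "deal w D i j = card {m. m < length D \<and> D ! m = i \<and> w ! m = j}"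

definition hand_prob ::
  "nat list \<Rightarrow> nat \<Rightarrow> (nat \<Rightarrow> nat) \<Rightarrow> nat \<Rightarrow> (nat \<Rightarrow> nat \<Rightarrow> nat) \<Rightarrow> real" where
  "hand_prob w k p a \<omega> =
     (\<Sum>D' | D' \<in> decks k p \<and> deal w D' = \<omega>. deck_prob a (ordered_deck k p) D')"

definition stationary ::
  "nat \<Rightarrow> nat \<Rightarrow> nat \<Rightarrow> (nat \<Rightarrow> nat) \<Rightarrow> (nat \<Rightarrow> nat \<Rightarrow> nat) \<Rightarrow> real" where
  "stationary s l k p \<omega> =
     fact s ^ l / fact (l * s) *
     (\<Prod>i\<in>{1..k}. fact (p i) / (\<Prod>j\<in>{1..l}. fact (\<omega> i j)))"

definition variation_distance ::
  "nat list \<Rightarrow> nat \<Rightarrow> nat \<Rightarrow> nat \<Rightarrow> (nat \<Rightarrow> nat) \<Rightarrow> nat \<Rightarrow> real" where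
  "variation_distance w s l k p a =
     1 / 2 * (\<Sum>\<omega>\<in>hands s l k p. \<bar>hand_prob w k p a \<omega> - stationary s l k p \<omega>\<bar>)"


subsection \<open>The coefficient of \<open>1 / a\<close>\<close>

definition has_inv_coeff :: "(nat \<Rightarrow> real) \<Rightarrow> real \<Rightarrow> bool" where
  "has_inv_coeff f \<kappa> \<longleftrightarrow>
     (\<lambda>a. f a - \<kappa> * (1 / real a)) \<in> O[at_top](\<lambda>a. 1 / real a ^ 2)"

lemma has_inv_coeff_unique:
  assumes "has_inv_coeff f \<kappa>" and "has_inv_coeff f \<kappa>'"
  shows "\<kappa> = \<kappa>'"
proof -
  have "(\<lambda>a. (f a - \<kappa>' * (1 / real a)) - (f a - \<kappa> * (1 / real a))) \<in> O[at_top](\<lambda>a. 1 / real a ^ 2)"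
    using sum_in_bigo(2)[OF assms(2,1)[unfolded has_inv_coeff_def]] .
  hence "(\<lambda>a. (\<kappa> - \<kappa>') * (1 / real a)) \<in> O[at_top](\<lambda>a. 1 / real a ^ 2)"
    by (simp add: algebra_simps diff_divide_distrib)
  then obtain c where "eventually (\<lambda>a. norm ((\<kappa> - \<kappa>') * (1 / real a)) \<le> c * norm (1 / real a ^ 2)) at_top"
    by (elim landau_o.bigE)
  hence "eventually (\<lambda>a. \<bar>\<kappa> - \<kappa>'\<bar> \<le> c * (1 / real a)) at_top"
    using eventually_gt_at_top[of 0]
    by eventually_elim (simp add: abs_mult field_simps power2_eq_square)
  moreover have "(\<lambda>a. c * (1 / real a)) \<longlonglongrightarrow> c * 0"
    by (intro tendsto_mult tendsto_const lim_1_over_n)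
  ultimately have "\<bar>\<kappa> - \<kappa>'\<bar> \<le> c * 0"
    by (intro tendsto_lowerbound[where F = sequentially]) auto
  thus ?thesis by simp
qed

end

theory Submission
  imports Defs "HOL-Combinatorics.Multiset_Permutations"
begin

text \<open>
  The weight of a cut depends only on its nonzero packets, so the probability of \<open>\<pi>\<close> is a sum over
  compositions \<open>r\<close> of \<open>n = l * s\<close> with coefficients \<open>(a choose length r) / a^n\<close>. Up to \<open>O(1 / a\<^sup>2)\<close> only
  compositions with at least \<open>n - 1\<close> parts matter, which gives
  \<open>1 / n! + (\<Sum>i. sgn (\<pi> (i + 1) - \<pi> i)) / (2 * (n - 1)! * a)\<close>.
  Summing over all \<open>\<pi>\<close> that deal a hand, the constant term is the stationary probability. In the
  linear term the positions \<open>\<pi> i\<close> and \<open>\<pi> (i + 1)\<close> are independent and uniform among the positions of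
  the two players concerned, so the dealing word enters only through the number of pairs of
  positions of players \<open>j\<close> and \<open>j'\<close> in which \<open>j\<close> precedes \<open>j'\<close>, minus the number of those in which
  it follows. For the three methods these excesses are proportional to each other, hence so are the
  linear terms for every single hand.
\<close>

subsection \<open>Shuffles as sums over compositions\<close>

text \<open>The packets are kept as a set without their indices, so that removing empty packets can
  change only whether \<open>{}\<close> is a member.\<close>

definition packets :: "nat list \<Rightarrow> nat set set" where
  "packets q = packet q ` {..<length q}"

lemma packets_Nil [simp]: "packets [] = {}"
  by (simp add: packets_def)

lemma packets_Cons: "packets (x # q) = insert {0..<x} ((`) ((+) x) ` packets q)"
proof -
  have "packets (x # q) = insert (packet (x # q) 0) ((\<lambda>j. packet (x # q) (Suc j)) ` {..<length q})"
    unfolding packets_def by (simp only: length_Cons lessThan_Suc_eq_insert_0 image_insert image_image)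
  moreover have "packet (x # q) 0 = {0..<x}"
    by (simp add: packet_def)
  moreover have "packet (x # q) (Suc j) = (+) x ` packet q j" for j
    by (simp add: packet_def add.commute)
  ultimately show ?thesis
    by (simp add: packets_def image_image)
qed

text \<open>A packet of size 0 does not shift the later ones and adds only \<open>{}\<close>;
  inserting \<open>{}\<close> on both sides absorbs it.\<close>

lemma insert_packets_filter: "insert {} (packets (filter (\<lambda>x. x \<noteq> 0) q)) = insert {} (packets q)"
proof (induction q)
  case (Cons x q)
  \<comment> \<open>Translation fixes \<open>{}\<close>, so the insertion moves under the image and
    the induction hypothesis becomes applicable.\<close>
  have *: "insert {} (packets (x # r)) = insert {0..<x} ((`) ((+) x) ` insert {} (packets r))" for r
    by (auto simp: packets_Cons)
  show ?case
  proof (cases "x = 0")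
    case True
    have "insert {} (packets (x # q)) = insert {} (packets q)"
      using True by (simp add: packets_Cons image_image)
    with Cons True show ?thesis by simp
  next
    case False
    then have "filter (\<lambda>x. x \<noteq> 0) (x # q) = x # filter (\<lambda>x. x \<noteq> 0) q" by simp
    then show ?thesis unfolding * Cons by (simp only: * Cons)
  qed
qed simp

lemma interleavings_packets:
  "interleavings n q = {\<pi>. \<pi> permutes {..<n} \<and> (\<forall>X\<in>insert {} (packets q). strict_mono_on X \<pi>)}"
  by (auto simp: interleavings_def packets_def strict_mono_on_def)

lemma interleavings_filter: "interleavings n (filter (\<lambda>x. x \<noteq> 0) q) = interleavings n q"
  unfolding interleavings_packets insert_packets_filter ..

text \<open>
  Empty packets impose no condition, so the weight of a cut depends only on its nonzero parts.
\<close>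

lemma card_lists_filter:
  assumes "0 \<notin> set r"
  shows "finite {q. length q = a \<and> filter (\<lambda>x. x \<noteq> 0) q = r} \<and>
         card {q. length q = a \<and> filter (\<lambda>x. x \<noteq> 0) q = (r :: nat list)} = a choose length r"
  using assms
proof (induction a arbitrary: r)
  case 0
  have "{q. length q = 0 \<and> filter (\<lambda>x. x \<noteq> 0) q = r} = (if r = [] then {[]} else {})"
    by auto
  then show ?case by (cases r) auto
next
  case (Suc a)
  let ?S = "\<lambda>a r. {q. length q = a \<and> filter (\<lambda>x. x \<noteq> 0) q = (r :: nat list)}"
  note IH = Suc.IH
  show ?case
  proof (cases r)
    case Nil
    have "?S (Suc a) r = (#) 0 ` ?S a r"
      using Nil by (auto simp: length_Suc_conv split: if_splits)
    then show ?thesis using IH[of r] Nil by (simp add: card_image)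
  next
    case (Cons y r')
    have y: "y \<noteq> 0" "0 \<notin> set r'" using Suc.prems Cons by auto
    \<comment> \<open>The first entry is either a skipped zero or \<open>y\<close>: this is Pascal's
      rule.\<close>
    have "?S (Suc a) r = (#) 0 ` ?S a r \<union> (#) y ` ?S a r'"
      using Cons y by (auto simp: length_Suc_conv split: if_splits)
    moreover have "card ((#) 0 ` ?S a r \<union> (#) y ` ?S a r') = card (?S a r) + card (?S a r')"
      using IH[of r] IH[of r'] y Suc.prems
      by (subst card_Un_disjoint) (auto simp: card_image)
    ultimately show ?thesis
      using IH[of r] IH[of r'] y Suc.prems Cons by simp
  qed
qed

definition compositions :: "nat \<Rightarrow> nat list set" where
  "compositions n = {r. 0 \<notin> set r \<and> sum_list r = n}"

lemma length_composition: "0 \<notin> set r \<Longrightarrow> length r \<le> sum_list (r :: nat list)"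
  by (induction r) auto

lemma finite_compositions: "finite (compositions n)"
proof (rule finite_subset)
  show "compositions n \<subseteq> {r. set r \<subseteq> {..n} \<and> length r \<le> n}"
    using length_composition by (auto simp: compositions_def member_le_sum_list)
  show "finite {r. set r \<subseteq> {..n} \<and> length r \<le> n}"
    by (rule finite_lists_length_le) simp
qed

lemma composition_length_eq:
  "0 \<notin> set r \<Longrightarrow> sum_list r = length r \<Longrightarrow> r = replicate (length r) (1 :: nat)"
proof (induction r)
  case (Cons x r)
  then show ?case using length_composition[of r] by auto
qed simp

text \<open>The compositions of \<open>n\<close> with \<open>n - 1\<close> parts, for \<open>i < n - 1\<close>.\<close>

definition doublet :: "nat \<Rightarrow> nat \<Rightarrow> nat list" where
  "doublet n i = replicate i 1 @ 2 # replicate (n - 2 - i) 1"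

text \<open>The sum exceeds the number of positive parts by one, so exactly one part is 2 and all
  others are 1.\<close>

lemma composition_length_Suc:
  "0 \<notin> set r \<Longrightarrow> sum_list r = Suc (length r) \<Longrightarrow> \<exists>i < length r. r = doublet (Suc (length r)) i"
proof (induction r)
  case (Cons x r)
  have le: "length r \<le> sum_list r" using Cons.prems length_composition[of r] by auto
  have "x = 1 \<or> x = 2" using Cons.prems le by auto
  then show ?case
  proof
    assume x: "x = 1"
    then obtain i where i: "i < length r" "r = doublet (Suc (length r)) i" using Cons by auto
    have "x # r = doublet (Suc (length (x # r))) (Suc i)"
      using x i(1) by (subst i(2)) (simp add: doublet_def Suc_diff_Suc)
    moreover have "Suc i < length (x # r)" using i(1) by simp
    ultimately show ?thesis by blast
  next
    assume x: "x = 2"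
    then have "r = replicate (length r) 1" using Cons.prems by (intro composition_length_eq) auto
    with x show ?thesis by (intro exI[of _ 0]) (simp add: doublet_def)
  qed
qed simp

text \<open>Cuts are grouped by their list of nonzero parts. Since \<open>fact 0 = 1\<close>, the
  weight is constant on each group, and all dependence on \<open>a\<close> is collected in the
  binomial coefficient and the power of \<open>a\<close>.\<close>

lemma shuffle_prob_eq:
  "shuffle_prob a n \<pi> = (\<Sum>r\<in>compositions n. real (a choose length r) / real a ^ n *
     (fact n / (\<Prod>x\<leftarrow>r. fact x) *
        (if \<pi> \<in> interleavings n r then 1 / real (card (interleavings n r)) else 0)))"
    (is "_ = (\<Sum>r\<in>_. _ * ?G r)")
proof -
  let ?F = "filter (\<lambda>x. x \<noteq> (0::nat))"
  have prod: "(\<Prod>x\<leftarrow>?F q. fact x) = (\<Prod>x\<leftarrow>q. fact x :: real)" for q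
    by (induction q) auto
  have sum: "sum_list (?F q) = sum_list q" for q
    by (induction q) auto
  have fin: "finite (cuts a n)"
    by (rule finite_subset[OF _ finite_lists_length_eq[of "{..n}" a]])
       (auto simp: cuts_def member_le_sum_list)
  have fib: "{q \<in> cuts a n. ?F q = r} = {q. length q = a \<and> ?F q = r}" if "r \<in> compositions n" for r
    using that sum by (auto simp: cuts_def compositions_def)
  have "shuffle_prob a n \<pi> = (\<Sum>q\<in>cuts a n. ?G (?F q) / real a ^ n)"
    unfolding shuffle_prob_def cut_prob_def
    by (intro sum.cong refl) (simp only: prod interleavings_filter, simp)
  also have "\<dots> = (\<Sum>r\<in>compositions n. \<Sum>q | q \<in> cuts a n \<and> ?F q = r. ?G (?F q) / real a ^ n)"
    using sum by (intro sum.group[symmetric, OF fin finite_compositions])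
       (auto simp: compositions_def cuts_def)
  also have "\<dots> = (\<Sum>r\<in>compositions n. real (a choose length r) / real a ^ n * ?G r)"
  proof (rule sum.cong[OF refl])
    fix r assume r: "r \<in> compositions n"
    have "(\<Sum>q | q \<in> cuts a n \<and> ?F q = r. ?G (?F q) / real a ^ n)
        = (\<Sum>q | q \<in> cuts a n \<and> ?F q = r. ?G r / real a ^ n)"
      by (rule sum.cong) auto
    also have "\<dots> = real (a choose length r) / real a ^ n * ?G r"
    proof -
      have "card {q \<in> cuts a n. ?F q = r} = a choose length r"
        unfolding fib[OF r] using r card_lists_filter[of r a] unfolding compositions_def by blast
      then show ?thesis unfolding sum_constant by (simp only: of_nat_mult) simp
    qed
    finally show "(\<Sum>q | q \<in> cuts a n \<and> ?F q = r. ?G (?F q) / real a ^ n)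
        = real (a choose length r) / real a ^ n * ?G r" .
  qed
  finally show ?thesis .
qed

section \<open>Interleavings for the compositions with \<open>n\<close> and \<open>n - 1\<close>
  parts\<close>

lemma packets_append: "packets (q @ r) = packets q \<union> (`) ((+) (sum_list q)) ` packets r"
proof (induction q)
  case (Cons x q)
  then show ?case by (auto simp: packets_Cons image_image image_Un add.assoc)
qed (auto simp: image_image)

lemma packets_ones: "X \<in> packets (replicate m (Suc 0)) \<Longrightarrow> \<exists>x. X = {x}"
  by (induction m arbitrary: X) (fastforce simp: packets_Cons)+

lemma interleavings_ones: "interleavings n (replicate m 1) = {\<pi>. \<pi> permutes {..<n}}"
  unfolding interleavings_packets
  by (auto dest!: packets_ones simp: strict_mono_on_def)

text \<open>Singleton packets impose no condition; only the packet \<open>{i, Suc i}\<close>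
  does.\<close>

lemma interleavings_doublet:
  "interleavings n (doublet n i) = {\<pi>. \<pi> permutes {..<n} \<and> \<pi> i < \<pi> (Suc i)}"
proof -
  have "{0..<2} = {0, 1::nat}" by auto
  then have "packets (doublet n i) = packets (replicate i 1) \<union>
      insert {i, Suc i} ((`) ((+) i) ` (`) ((+) 2) ` packets (replicate (n - 2 - i) 1))"
    by (simp add: doublet_def packets_append packets_Cons sum_list_replicate)
  then show ?thesis
    unfolding interleavings_packets
    by (auto dest!: packets_ones simp: strict_mono_on_def)
qed

text \<open>Precomposition with the transposition of \<open>i\<close> and \<open>Suc i\<close>
  exchanges ascents and descents at \<open>i\<close>, so exactly half of all permutations ascend
  there.\<close>

lemma card_permutes_ascent:
  assumes "Suc i < n"
  shows "2 * card {\<pi>. \<pi> permutes {..<n} \<and> \<pi> i < \<pi> (Suc i)} = fact n"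
proof -
  let ?t = "transpose i (Suc i)"
  let ?A = "{\<pi>. \<pi> permutes {..<n} \<and> \<pi> i < \<pi> (Suc i)}"
  let ?B = "{\<pi>. \<pi> permutes {..<n} \<and> \<pi> (Suc i) < \<pi> i}"
  have t: "?t permutes {..<n}" using assms by (intro permutes_swap_id) auto
  have "bij_betw (\<lambda>\<pi>. \<pi> \<circ> ?t) ?A ?B"
    by (rule bij_betwI[of _ _ _ "\<lambda>\<pi>. \<pi> \<circ> ?t"])
       (auto simp: fun_eq_iff intro: permutes_compose[OF t])
  then have "card ?A = card ?B" by (rule bij_betw_same_card)
  moreover have "card (?A \<union> ?B) = card ?A + card ?B"
    by (rule card_Un_disjoint) (auto intro: finite_subset[OF _ finite_permutations[of "{..<n}"]])
  moreover have "?A \<union> ?B = {\<pi>. \<pi> permutes {..<n}}"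
  proof -
    have "\<pi> i \<noteq> \<pi> (Suc i)" if "\<pi> permutes {..<n}" for \<pi>
      using that by (metis n_not_Suc_n permutes_inj injD)
    then show ?thesis by (auto simp: nat_neq_iff)
  qed
  moreover have "card {\<pi>. \<pi> permutes {..<n}} = fact n" by (rule card_permutations) auto
  ultimately show ?thesis by simp
qed

lemma inj_doublet: "inj (doublet n)"
proof (rule injI, rule ccontr)
  fix i j assume eq: "doublet n i = doublet n j" and "i \<noteq> j"
  have *: False if "i < j" "doublet n i = doublet n j" for i j
  proof -
    have "doublet n i ! i = 2" "doublet n j ! i = 1"
      using that(1) by (simp_all add: doublet_def nth_append)
    with that show False by simp
  qed
  show False using \<open>i \<noteq> j\<close> eq *[of i j] *[of j i] by (metis nat_neq_iff)
qed

subsection \<open>Expansions up to first order in \<open>1 / a\<close>\<close>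

text \<open>For \<open>c = 0\<close> this is \<open>has_inv_coeff\<close>; the constant term is
  carried along because it becomes the stationary probability.\<close>

definition first_order :: "(nat \<Rightarrow> real) \<Rightarrow> real \<Rightarrow> real \<Rightarrow> bool" where
  "first_order f c d \<longleftrightarrow> (\<lambda>a. f a - c - d * (1 / real a)) \<in> O[at_top](\<lambda>a. 1 / real a ^ 2)"

lemma first_order_const: "first_order (\<lambda>_. c) c 0"
  by (simp add: first_order_def)

lemma first_order_add:
  assumes "first_order f c d" "first_order g c' d'"
  shows "first_order (\<lambda>a. f a + g a) (c + c') (d + d')"
  using sum_in_bigo(1)[OF assms[unfolded first_order_def]]
  by (simp add: first_order_def algebra_simps add_divide_distrib)

lemma first_order_cmult:
  assumes "first_order f c d"
  shows "first_order (\<lambda>a. x * f a) (x * c) (x * d)"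
  using landau_o.big.mult[OF bigo_const[of x] assms[unfolded first_order_def]]
  by (simp add: first_order_def algebra_simps)

lemma first_order_sum:
  assumes "\<And>x. x \<in> A \<Longrightarrow> first_order (f x) (c x) (d x)"
  shows "first_order (\<lambda>a. \<Sum>x\<in>A. f x a) (\<Sum>x\<in>A. c x) (\<Sum>x\<in>A. d x)"
  using assms
  by (induction A rule: infinite_finite_induct) (auto intro: first_order_const first_order_add)

lemma inv_in_bigo_1: "(\<lambda>a. 1 / real a) \<in> O[at_top](\<lambda>_. 1)"
  by (rule bigoI[of _ 1]) (auto intro!: eventually_mono[OF eventually_gt_at_top[of 0]])

lemma inv_power_in_bigo:
  assumes "m \<ge> 2"
  shows "(\<lambda>a. 1 / real a ^ m) \<in> O[at_top](\<lambda>a. 1 / real a ^ 2)"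
  using assms
  by (intro bigoI[of _ 1] eventually_mono[OF eventually_gt_at_top[of 0]])
     (auto simp: divide_simps intro!: power_increasing)

lemma first_order_bounded:
  assumes "first_order f c d"
  shows "f \<in> O[at_top](\<lambda>_. 1)"
proof -
  have "(\<lambda>a. 1 / real a ^ 2) \<in> O[at_top](\<lambda>_. 1)"
    using landau_o.big.mult[OF inv_in_bigo_1 inv_in_bigo_1] by (simp add: power2_eq_square)
  then have "(\<lambda>a. f a - c - d * (1 / real a)) \<in> O[at_top](\<lambda>_. 1)"
    using assms unfolding first_order_def by (rule landau_o.big_trans[rotated])
  moreover have "(\<lambda>a. c + d * (1 / real a)) \<in> O[at_top](\<lambda>_. 1)"
    using landau_o.big.mult[OF bigo_const[of d] inv_in_bigo_1]
    by (intro sum_in_bigo(1) bigo_const) simp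
  ultimately show ?thesis using sum_in_bigo(1) by fastforce
qed

text \<open>Division by \<open>a\<close> moves \<open>c\<close> to the linear term and sends the old
  linear term into the error.\<close>

lemma first_order_divide:
  assumes "first_order f c d"
  shows "first_order (\<lambda>a. f a * (1 / real a)) 0 c"
proof -
  have "(\<lambda>a. f a - c) \<in> O[at_top](\<lambda>a. 1 / real a)"
  proof -
    have "(\<lambda>a. f a - c - d * (1 / real a)) \<in> O[at_top](\<lambda>a. 1 / real a)"
      using assms landau_o.big.mult[OF inv_in_bigo_1 landau_o.big_refl[of "\<lambda>a. 1 / real a"]]
      unfolding first_order_def
      by (auto simp: power2_eq_square intro: landau_o.big_trans)
    moreover have "(\<lambda>a. d * (1 / real a)) \<in> O[at_top](\<lambda>a. 1 / real a)"
      using landau_o.big.mult[OF bigo_const[of d] landau_o.big_refl[of "\<lambda>a. 1 / real a"]] by simp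
    ultimately show ?thesis using sum_in_bigo(1) by fastforce
  qed
  from landau_o.big.mult[OF this landau_o.big_refl[of "\<lambda>a. 1 / real a"]] show ?thesis
    by (simp add: first_order_def power2_eq_square algebra_simps diff_divide_distrib)
qed

text \<open>Multiplying by one more factor subtracts \<open>m / a\<close> times the product so far,
  whose leading term is 1.\<close>

lemma first_order_prod:
  "first_order (\<lambda>a. \<Prod>i<m. 1 - real i / real a) 1 (- (\<Sum>i<m. real i))"
proof (induction m)
  case (Suc m)
  from first_order_add[OF Suc first_order_cmult[OF first_order_divide[OF Suc], of "- real m"]]
  show ?case by (simp add: algebra_simps)
qed (simp add: first_order_def)

lemma first_order_cong:
  assumes "first_order f c d" "\<And>a. a > 0 \<Longrightarrow> f a = g a"
  shows "first_order g c d"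
proof -
  have ev: "eventually (\<lambda>a. f a - c - d * (1 / real a) = g a - c - d * (1 / real a)) at_top"
    using eventually_gt_at_top[of 0] by eventually_elim (simp add: assms(2))
  then show ?thesis using assms(1) landau_o.big.in_cong[OF ev]
    by (simp add: first_order_def)
qed

section \<open>Binomial coefficients divided by powers of \<open>a\<close>\<close>

lemma binomial_over_power:
  assumes "a > 0"
  shows "real (a choose m) / real a ^ m = 1 / fact m * (\<Prod>i<m. 1 - real i / real a)"
proof -
  have "real a ^ m * (\<Prod>i<m. 1 - real i / real a) = (\<Prod>i<m. real a - real i)"
    using assms by (induction m) (simp_all add: field_simps)
  moreover have "real (a choose m) = (\<Prod>i<m. real a - real i) / fact m"
    by (simp add: binomial_gbinomial gbinomial_prod_rev atLeast0LessThan)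
  ultimately show ?thesis using assms by (simp add: field_simps)
qed

lemma first_order_binomial:
  "first_order (\<lambda>a. real (a choose m) / real a ^ m) (1 / fact m) (- (\<Sum>i<m. real i) / fact m)"
  using first_order_cong[OF first_order_cmult[OF first_order_prod, of "1 / fact m"]]
  by (simp add: binomial_over_power)

lemma first_order_binomial_Suc:
  "first_order (\<lambda>a. real (a choose m) / real a ^ Suc m) 0 (1 / fact m)"
  using first_order_divide[OF first_order_binomial[of m]] by (simp add: field_simps)

lemma first_order_binomial_less:
  assumes "m + 2 \<le> n"
  shows "first_order (\<lambda>a. real (a choose m) / real a ^ n) 0 0"
proof -
  have "(\<lambda>a. 1 / real a ^ (n - m)) \<in> O[at_top](\<lambda>a. 1 / real a ^ 2)"
    using assms by (intro inv_power_in_bigo) simp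
  from landau_o.big.mult[OF first_order_bounded[OF first_order_binomial[of m]] this]
  have *: "(\<lambda>a. real (a choose m) / real a ^ m * (1 / real a ^ (n - m))) \<in> O[at_top](\<lambda>a. 1 / real a ^ 2)"
    by simp
  have "real a ^ m * real a ^ (n - m) = real a ^ n" for a
    using assms by (simp flip: power_add)
  then have eq: "real (a choose m) / real a ^ m * (1 / real a ^ (n - m)) = real (a choose m) / real a ^ n" for a
    unfolding times_divide_times_eq by simp
  show ?thesis using * unfolding eq by (simp add: first_order_def)
qed

text \<open>The all-ones composition contributes \<open>1 / n!\<close> and the linear coefficient
  \<open>- (n - 1) / (2 * (n - 1)!)\<close>; each \<open>doublet n i\<close> contributes
  \<open>1 / (n - 1)!\<close> if \<pi> ascends at \<open>i\<close>. Splitting the negative term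
  evenly over the \<open>n - 1\<close> places turns each ascent indicator into half a sign.\<close>

lemma first_order_shuffle_prob:
  assumes "n \<ge> 1" "\<pi> permutes {..<n}"
  shows "first_order (\<lambda>a. shuffle_prob a n \<pi>) (1 / fact n)
    (1 / (2 * fact (n - 1)) * (\<Sum>i<n-1. sgn (real (\<pi> (Suc i)) - real (\<pi> i))))"
proof -
  \<comment> \<open>\<open>G r\<close> is the part of the weight that is free of \<open>a\<close>;
    \<open>d m\<close> is the linear coefficient of \<open>(a choose m) / a^n\<close>.\<close>
  define G where "G r = fact n / (\<Prod>x\<leftarrow>r. fact x) *
    (if \<pi> \<in> interleavings n r then 1 / real (card (interleavings n r)) else 0)" for r
  define d where "d m = (if m = n then - (\<Sum>i<n. real i) / fact n else
                         if Suc m = n then 1 / fact m else 0)" for m :: nat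
  have fo: "first_order (\<lambda>a. real (a choose length r) / real a ^ n)
      (if length r = n then 1 / fact n else 0) (d (length r))" if "r \<in> compositions n" for r
  proof -
    have le: "length r \<le> n" using that length_composition[of r] by (auto simp: compositions_def)
    consider "length r = n" | "Suc (length r) = n" | "length r + 2 \<le> n" using le by linarith
    then show ?thesis
      using first_order_binomial[of n] first_order_binomial_Suc[of "length r"]
        first_order_binomial_less[of "length r" n]
      by cases (auto simp: d_def)
  qed
  have lenn: "r \<in> compositions n \<and> length r = n \<longleftrightarrow> r = replicate n 1" for r
    using composition_length_eq[of r] by (auto simp: compositions_def sum_list_replicate)
  have lenS: "{r \<in> compositions n. Suc (length r) = n} = doublet n ` {..<n-1}"
  proof (intro equalityI subsetI)
    fix r assume "r \<in> {r \<in> compositions n. Suc (length r) = n}"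
    then show "r \<in> doublet n ` {..<n-1}"
      using composition_length_Suc[of r] by (auto simp: compositions_def)
  qed (auto simp: compositions_def doublet_def sum_list_replicate)
  have G1: "G (replicate n 1) = 1"
    using assms card_permutations[of "{..<n}" n]
    by (simp add: G_def interleavings_ones del: One_nat_def)
  \<comment> \<open>The multinomial coefficient is \<open>n! / 2\<close>, and so is the number of
    interleavings.\<close>
  have G2: "G (doublet n i) = of_bool (\<pi> i < \<pi> (Suc i))" if "i < n - 1" for i
  proof -
    have "real (2 * card (interleavings n (doublet n i))) = real (fact n)"
      using card_permutes_ascent[of i n] that by (simp only: interleavings_doublet)
    then have "real (card (interleavings n (doublet n i))) = fact n / 2" by simp
    moreover have "(\<Prod>x\<leftarrow>doublet n i. fact x) = (2 :: real)"
      by (simp add: doublet_def)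
    moreover have "\<pi> \<in> interleavings n (doublet n i) \<longleftrightarrow> \<pi> i < \<pi> (Suc i)"
      using assms by (simp add: interleavings_doublet)
    ultimately show ?thesis unfolding G_def by (simp only:) simp
  qed
  have sgn: "2 * of_bool (\<pi> i < \<pi> (Suc i)) - 1 = sgn (real (\<pi> (Suc i)) - real (\<pi> i))" for i
  proof -
    have "\<pi> i \<noteq> \<pi> (Suc i)" using assms(2) by (metis n_not_Suc_n permutes_inj injD)
    then show ?thesis by (auto simp: sgn_if)
  qed
  have "first_order (\<lambda>a. \<Sum>r\<in>compositions n. G r * (real (a choose length r) / real a ^ n))
     (\<Sum>r\<in>compositions n. G r * (if length r = n then 1 / fact n else 0))
     (\<Sum>r\<in>compositions n. G r * d (length r))"
    by (intro first_order_sum first_order_cmult fo)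
  moreover have "(\<Sum>r\<in>compositions n. G r * (real (a choose length r) / real a ^ n)) = shuffle_prob a n \<pi>" for a
    unfolding shuffle_prob_eq G_def by (simp add: mult.commute)
  moreover have "(\<Sum>r\<in>compositions n. G r * (if length r = n then 1 / fact n else 0)) = 1 / fact n"
  proof -
    have "(\<Sum>r\<in>compositions n. G r * (if length r = n then 1 / fact n else 0)) =
      (\<Sum>r\<in>{replicate n 1}. G r * (1 / fact n))"
      using finite_compositions lenn by (intro sum.mono_neutral_cong_right) auto
    then show ?thesis using G1 by simp
  qed
  moreover have "(\<Sum>r\<in>compositions n. G r * d (length r)) =
     1 / (2 * fact (n - 1)) * (\<Sum>i<n-1. sgn (real (\<pi> (Suc i)) - real (\<pi> i)))"
  proof -
    have dis: "replicate n 1 \<notin> doublet n ` {..<n-1}"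
      using lenS lenn by (metis (mono_tags, lifting) length_replicate mem_Collect_eq n_not_Suc_n)
    have "(\<Sum>r\<in>compositions n. G r * d (length r)) =
      (\<Sum>r\<in>insert (replicate n 1) (doublet n ` {..<n-1}). G r * d (length r))"
      using finite_compositions lenn unfolding lenS[symmetric]
      by (intro sum.mono_neutral_right) (auto simp: d_def)
    also have "\<dots> = G (replicate n 1) * d n + (\<Sum>i<n-1. G (doublet n i) * d (length (doublet n i)))"
      using dis inj_doublet[of n] by (simp add: sum.reindex inj_on_subset)
    also have "(\<Sum>i<n-1. G (doublet n i) * d (length (doublet n i))) =
       (\<Sum>i<n-1. of_bool (\<pi> i < \<pi> (Suc i)) * (1 / fact (n - 1)))"
    proof (intro sum.cong refl)
      fix i assume i: "i \<in> {..<n-1}"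
      then have "doublet n i \<in> {r \<in> compositions n. Suc (length r) = n}" unfolding lenS by blast
      then have "length (doublet n i) = n - 1" and "n - 1 \<noteq> n" and "Suc (n - 1) = n" by auto
      with i show "G (doublet n i) * d (length (doublet n i)) =
          of_bool (\<pi> i < \<pi> (Suc i)) * (1 / fact (n - 1))"
        by (simp only: G2 d_def lessThan_iff simp_thms if_True if_False)
    qed
    also have "G (replicate n 1) * d n + \<dots> = 1 / (2 * fact (n - 1)) *
        (2 * (\<Sum>i<n-1. of_bool (\<pi> i < \<pi> (Suc i))) - real (n - 1))"
    proof -
      have S: "(\<Sum>i<n. real i) = real n * real (n - 1) / 2"
      proof (induction n)
        case (Suc n)
        then show ?case by (cases n) (simp_all add: field_simps)
      qed simp
      have F: "(fact n :: real) = real n * fact (n - 1)"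
        using assms(1) by (simp add: fact_reduce)
      have d: "d n = - (real (n - 1) / (2 * fact (n - 1)))"
        using assms(1) by (simp add: d_def S F)
      show ?thesis
        unfolding G1 d sum_distrib_right[symmetric] by (simp add: field_simps)
    qed
    also have "2 * (\<Sum>i<n-1. of_bool (\<pi> i < \<pi> (Suc i))) - real (n - 1) =
      (\<Sum>i<n-1. 2 * of_bool (\<pi> i < \<pi> (Suc i)) - 1)"
      by (simp add: sum_subtractf sum_distrib_left)
    finally show ?thesis by (simp only: sgn)
  qed
  ultimately show ?thesis by simp
qed

subsection \<open>Counting the shuffles that deal a given hand\<close>

text \<open>Permutations of positions act transitively on the rearrangements of \<open>ys\<close>,
  so all fibres \<open>N\<close> have the same size, namely \<open>n!\<close> divided by the number
  of rearrangements.\<close>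

lemma card_permute_list_eq:
  assumes "mset xs = mset ys"
  shows "card {f. f permutes {..<length ys} \<and> permute_list f ys = xs} =
    (\<Prod>x\<in>set ys. fact (count (mset ys) x))"
proof -
  define N where "N xs = {f. f permutes {..<length ys} \<and> permute_list f ys = xs}" for xs
  let ?P = "permutations_of_multiset (mset ys)"
  have fin: "finite (N xs)" for xs
    by (rule finite_subset[OF _ finite_permutations[of "{..<length ys}"]]) (auto simp: N_def)
  have le: "card (N xs) \<le> card (N zs)" if m: "mset xs = mset ys" "mset zs = mset ys" for xs zs
  proof -
    \<comment> \<open>Composing on the right with a \<open>g\<close> that takes \<open>xs\<close> to
      \<open>zs\<close> injects one fibre into the other.\<close>
    have "mset zs = mset xs" using m by simp
    then obtain g where g: "g permutes {..<length xs}" "permute_list g xs = zs"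
      by (rule mset_eq_permutation)
    have len: "length xs = length ys" using m(1) mset_eq_length by metis
    show ?thesis
    proof (rule card_inj_on_le)
      show "inj_on (\<lambda>f. f \<circ> g) (N xs)"
        using permutes_surj[OF g(1)] by (auto simp: inj_on_def fun_eq_iff) (metis surjD)
      show "(\<lambda>f. f \<circ> g) ` N xs \<subseteq> N zs"
        using g len by (auto simp: N_def permute_list_compose intro: permutes_compose)
    qed (rule fin)
  qed
  have xs: "xs \<in> ?P" using assms by (simp add: permutations_of_multiset_def)
  have "fact (length ys) = card {f. f permutes {..<length ys}}"
    by (rule card_permutations[symmetric]) auto
  also have "\<dots> = (\<Sum>f | f permutes {..<length ys}. 1)" by simp
  also have "\<dots> = (\<Sum>zs\<in>?P. \<Sum>f | f \<in> {f. f permutes {..<length ys}} \<and> permute_list f ys = zs. 1)"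
    by (rule sum.group[symmetric]) (auto simp: finite_permutations intro!: permutations_of_multisetI)
  also have "\<dots> = (\<Sum>zs\<in>?P. card (N zs))"
    by (simp add: N_def)
  also have "\<dots> = (\<Sum>zs\<in>?P. card (N xs))"
    using le assms by (intro sum.cong refl antisym) (auto simp: permutations_of_multiset_def)
  finally have "fact (length ys) = card ?P * card (N xs)" by simp
  moreover have "card ?P * (\<Prod>x\<in>set ys. fact (count (mset ys) x)) = fact (length ys)"
    using card_permutations_of_multiset_aux[of "mset ys"] by simp
  moreover have "card ?P > 0" using xs by (auto simp: card_gt_0_iff)
  ultimately have "card (N xs) = (\<Prod>x\<in>set ys. fact (count (mset ys) x))" by simp
  then show ?thesis by (simp add: N_def)
qed

text \<open>Letters that do not occur contribute \<open>0! = 1\<close>, so the product may run over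
  the whole alphabet.\<close>

lemma card_permute_list_eq':
  assumes "mset xs = mset ys" "set ys \<subseteq> A" "finite A"
  shows "card {f. f permutes {..<length ys} \<and> permute_list f ys = xs} =
    (\<Prod>x\<in>A. fact (count (mset ys) x))"
  unfolding card_permute_list_eq[OF assms(1)] using assms(2,3)
  by (intro prod.mono_neutral_left) (auto simp: count_mset count_list_0_iff)

lemma count_mset_card: "count (mset xs) x = card {m. m < length xs \<and> xs ! m = x}"
  by (simp add: count_mset count_list_eq_length_filter length_filter_conv_card eq_commute)

lemma mset_concat_replicate:
  "mset (concat (map (\<lambda>i. replicate (f i) i) [a..<b])) = (\<Sum>i\<in>{a..<b}. replicate_mset (f i) i)"
  by (induction b) (auto simp: atLeastLessThanSuc add.commute)

lemma count_sum_replicate_mset: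
  assumes "finite A"
  shows "count (\<Sum>i\<in>A. replicate_mset (f i) i) j = (if j \<in> A then f j else 0)"
  using assms by (simp add: count_sum if_distrib cong: if_cong)

lemma mset_ordered_deck: "mset (ordered_deck k p) = (\<Sum>i\<in>{1..k}. replicate_mset (p i) i)"
  unfolding ordered_deck_def mset_concat_replicate by (simp add: atLeastLessThanSuc_atLeastAtMost)

lemma mset_ordered_dealing: "mset (ordered_dealing s l) = (\<Sum>j\<in>{1..l}. replicate_mset s j)"
  unfolding ordered_dealing_def mset_concat_replicate[of "\<lambda>_. s"]
  by (simp add: atLeastLessThanSuc_atLeastAtMost)

lemma count_ordered_deck: "count (mset (ordered_deck k p)) i = (if i \<in> {1..k} then p i else 0)"
  unfolding mset_ordered_deck by (rule count_sum_replicate_mset) simp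

lemma count_ordered_dealing: "count (mset (ordered_dealing s l)) j = (if j \<in> {1..l} then s else 0)"
  unfolding mset_ordered_dealing by (rule count_sum_replicate_mset) simp

lemma set_ordered_deck: "set (ordered_deck k p) \<subseteq> {1..k}"
  by (auto simp: ordered_deck_def)

lemma set_ordered_dealing: "set (ordered_dealing s l) \<subseteq> {1..l}"
  by (auto simp: ordered_dealing_def)

lemma length_ordered_deck: "length (ordered_deck k p) = (\<Sum>i\<in>{1..k}. p i)"
  by (simp add: ordered_deck_def length_concat comp_def interv_sum_list_conv_sum_set_nat
      atLeastLessThanSuc_atLeastAtMost del: upt_Suc)

lemma length_ordered_dealing: "length (ordered_dealing s l) = l * s"
  by (simp add: ordered_dealing_def length_concat comp_def sum_list_triv del: upt_Suc)

text \<open>The shuffled deck is eliminated: the card at position \<open>m\<close> of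
  \<open>D\<close> moves to \<open>\<pi> m\<close> and thus reaches player
  \<open>w ! \<pi> m\<close>.\<close>

definition dealt :: "nat list \<Rightarrow> nat list \<Rightarrow> (nat \<Rightarrow> nat \<Rightarrow> nat) \<Rightarrow> (nat \<Rightarrow> nat) set" where
  "dealt w D \<omega> = {\<pi>. \<pi> permutes {..<length D} \<and>
     (\<lambda>i j. card {m. m < length D \<and> D ! m = i \<and> w ! \<pi> m = j}) = \<omega>}"

lemma finite_dealt [simp]: "finite (dealt w D \<omega>)"
  by (rule finite_subset[OF _ finite_permutations[of "{..<length D}"]]) (auto simp: dealt_def)

lemma transforms_iff:
  assumes "\<pi> permutes {..<length D}"
  shows "transforms \<pi> D D' \<longleftrightarrow> D' = permute_list (inv \<pi>) D"
proof
  note inv = permutes_inv[OF assms]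
  assume t: "transforms \<pi> D D'"
  show "D' = permute_list (inv \<pi>) D"
  proof (rule nth_equalityI)
    fix m assume "m < length D'"
    with t have m: "m < length D" by (simp add: transforms_def)
    then have "inv \<pi> m < length D" using permutes_in_image[OF inv, of m] by simp
    then have "D' ! \<pi> (inv \<pi> m) = D ! inv \<pi> m" using t by (simp add: transforms_def)
    then show "D' ! m = permute_list (inv \<pi>) D ! m"
      by (simp add: permute_list_nth[OF inv m] permutes_inverses[OF assms])
  qed (use t in \<open>simp add: transforms_def\<close>)
next
  assume D': "D' = permute_list (inv \<pi>) D"
  have "D' ! \<pi> i = D ! i" if "i < length D" for i
    using that permutes_in_image[OF assms, of i]
    by (simp add: D' permute_list_nth[OF permutes_inv[OF assms]] permutes_inverses[OF assms])
  then show "transforms \<pi> D D'" by (simp add: transforms_def D')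
qed

lemma deal_permute_list:
  assumes "\<pi> permutes {..<length D}"
  shows "deal w (permute_list (inv \<pi>) D) i j = card {m. m < length D \<and> D ! m = i \<and> w ! \<pi> m = j}"
proof -
  note inv = permutes_inv[OF assms]
  have in_D: "\<pi> m < length D \<longleftrightarrow> m < length D" "inv \<pi> m < length D \<longleftrightarrow> m < length D" for m
    using permutes_in_image[OF assms, of m] permutes_in_image[OF inv, of m] by simp_all
  have "bij_betw \<pi> {m. m < length D \<and> D ! m = i \<and> w ! \<pi> m = j}
     {m. m < length D \<and> permute_list (inv \<pi>) D ! m = i \<and> w ! m = j}"
    by (rule bij_betwI[of _ _ _ "inv \<pi>"])
       (auto simp: permute_list_nth[OF inv] permutes_inverses[OF assms] in_D)
  then show ?thesis unfolding deal_def by (simp add: bij_betw_same_card)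
qed

text \<open>Each \<pi> takes the initial deck to exactly one deck,
  \<open>permute_list (inv \<pi>) D\<close>, so the sum over decks and permutations collapses to one
  over permutations.\<close>

lemma hand_prob_eq:
  "hand_prob w k p a \<omega> =
    (\<Sum>\<pi>\<in>dealt w (ordered_deck k p) \<omega>. shuffle_prob a (length (ordered_deck k p)) \<pi>)"
proof -
  let ?D = "ordered_deck k p"
  let ?X = "{D'. D' \<in> decks k p \<and> deal w D' = \<omega>}"
  have in_decks: "permute_list (inv \<pi>) ?D \<in> decks k p" if "\<pi> permutes {..<length ?D}" for \<pi>
    using permutes_inv[OF that] set_ordered_deck count_ordered_deck[of k p]
    by (auto simp: decks_def length_ordered_deck simp flip: count_mset)
  have fin: "finite ?X"
    by (rule finite_subset[OF _ finite_lists_length_eq[of "{1..k}"]]) (auto simp: decks_def)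
  have "(\<Sum>\<pi>\<in>dealt w ?D \<omega>. shuffle_prob a (length ?D) \<pi>) =
    (\<Sum>D'\<in>?X. \<Sum>\<pi> | \<pi> \<in> dealt w ?D \<omega> \<and> permute_list (inv \<pi>) ?D = D'. shuffle_prob a (length ?D) \<pi>)"
  proof (rule sum.group[symmetric])
    show "(\<lambda>\<pi>. permute_list (inv \<pi>) ?D) ` dealt w ?D \<omega> \<subseteq> ?X"
      by (auto simp: dealt_def in_decks deal_permute_list intro!: ext)
  qed (simp_all add: fin)
  also have "\<dots> = hand_prob w k p a \<omega>"
    unfolding hand_prob_def deck_prob_def
    by (intro sum.cong refl)
       (auto simp: dealt_def transforms_iff deal_permute_list fun_eq_iff)
  finally show ?thesis ..
qed

text \<open>Pairing every card's colour with its receiver turns a hand into a multiset of pairs, and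
  the question into one about rearrangements of lists.\<close>

lemma dealt_iff:
  assumes "length w = length D"
  shows "\<pi> \<in> dealt w D \<omega> \<longleftrightarrow> \<pi> permutes {..<length D} \<and>
    (\<forall>i j. count (mset (zip D (permute_list \<pi> w))) (i, j) = \<omega> i j)"
proof (cases "\<pi> permutes {..<length D}")
  case True
  have "{m. m < length D \<and> zip D (permute_list \<pi> w) ! m = (i, j)} =
        {m. m < length D \<and> D ! m = i \<and> w ! \<pi> m = j}" for i j
    using assms True by (auto simp: permute_list_nth)
  then show ?thesis using True assms by (simp add: dealt_def count_mset_card fun_eq_iff)
qed (simp add: dealt_def)

definition hand_mset :: "nat \<Rightarrow> nat \<Rightarrow> (nat \<Rightarrow> nat \<Rightarrow> nat) \<Rightarrow> (nat \<times> nat) multiset" where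
  "hand_mset k l \<omega> = (\<Sum>i\<in>{1..k}. \<Sum>j\<in>{1..l}. replicate_mset (\<omega> i j) (i, j))"

lemma count_hand_mset:
  assumes "\<omega> \<in> hands s l k p"
  shows "count (hand_mset k l \<omega>) (i, j) = \<omega> i j"
proof -
  have "hand_mset k l \<omega> = (\<Sum>x\<in>{1..k} \<times> {1..l}. replicate_mset (case x of (i, j) \<Rightarrow> \<omega> i j) x)"
    unfolding hand_mset_def by (simp add: sum.cartesian_product case_prod_unfold)
  then have "count (hand_mset k l \<omega>) (i, j) = (if (i, j) \<in> {1..k} \<times> {1..l} then \<omega> i j else 0)"
    using count_sum_replicate_mset[of "{1..k} \<times> {1..l}" "\<lambda>(i, j). \<omega> i j" "(i, j)"] by simp
  then show ?thesis using assms by (auto simp: hands_def)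
qed

lemma sum_replicate_mset: "(\<Sum>j\<in>A. replicate_mset (f j) x) = replicate_mset (\<Sum>j\<in>A. f j) x"
  by (rule multiset_eqI) (simp add: count_sum)

lemma image_mset_sum: "image_mset f (\<Sum>i\<in>A. g i) = (\<Sum>i\<in>A. image_mset f (g i))"
  by (induction A rule: infinite_finite_induct) auto

lemma hand_mset_fst:
  assumes "\<omega> \<in> hands s l k p"
  shows "image_mset fst (hand_mset k l \<omega>) = mset (ordered_deck k p)"
  using assms unfolding hand_mset_def mset_ordered_deck
  by (simp add: image_mset_sum sum_replicate_mset hands_def)

lemma hand_mset_snd:
  assumes "\<omega> \<in> hands s l k p"
  shows "image_mset snd (hand_mset k l \<omega>) = mset (ordered_dealing s l)"
  using assms unfolding hand_mset_def mset_ordered_dealing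
  by (subst sum.swap) (simp add: image_mset_sum sum_replicate_mset hands_def)

text \<open>
  Fix a list \<open>xs\<close> of (colour, player) pairs that realises \<open>\<omega>\<close>. Pairs of rearrangements \<open>\<alpha>\<close>, \<open>\<beta>\<close>
  that align the deck and the dealing word with \<open>xs\<close> are counted directly, and
  \<open>(\<alpha>, \<beta>) \<mapsto> \<beta> \<circ> inv \<alpha>\<close> maps them onto the shuffles in question with fibres of constant size.
\<close>

lemma card_dealt:
  assumes \<omega>: "\<omega> \<in> hands s l k p" and w: "mset w = mset (ordered_dealing s l)"
    and len: "(\<Sum>i\<in>{1..k}. p i) = l * s"
  shows "card (dealt w (ordered_deck k p) \<omega>) * (\<Prod>i\<in>{1..k}. \<Prod>j\<in>{1..l}. fact (\<omega> i j)) =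
    (\<Prod>i\<in>{1..k}. fact (p i)) * fact s ^ l"
proof -
  let ?D = "ordered_deck k p" and ?M = "hand_mset k l \<omega>"
  let ?n = "l * s"
  have lenD: "length ?D = ?n" using len by (simp add: length_ordered_deck)
  have lenw: "length w = ?n" using w length_ordered_dealing mset_eq_length by metis
  obtain xs where xs: "mset xs = ?M" using ex_mset by blast
  have fst_xs: "mset (map fst xs) = mset ?D" using hand_mset_fst[OF \<omega>] xs by simp
  have snd_xs: "mset (map snd xs) = mset w" using hand_mset_snd[OF \<omega>] xs w by simp
  have lenxs: "length xs = ?n" using fst_xs lenD mset_eq_length length_map by metis
  \<comment> \<open>\<open>A\<close> aligns the deck with the colours in \<open>xs\<close>,
    \<open>B\<close> the word with the players; \<open>C \<pi>\<close> is the fibre over \<pi>. All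
    three are counted by \<open>card_permute_list_eq'\<close>.\<close>
  define A where "A = {f. f permutes {..<?n} \<and> permute_list f ?D = map fst xs}"
  define B where "B = {f. f permutes {..<?n} \<and> permute_list f w = map snd xs}"
  define C where "C \<pi> = {f. f permutes {..<?n} \<and> permute_list f (zip ?D (permute_list \<pi> w)) = xs}" for \<pi>
  have cardA: "card A = (\<Prod>i\<in>{1..k}. fact (p i))"
    unfolding A_def using card_permute_list_eq'[OF fst_xs set_ordered_deck]
    by (simp add: lenD count_ordered_deck)
  have setw: "set w \<subseteq> {1..l}" using w set_ordered_dealing mset_eq_setD by metis
  have cardB: "card B = fact s ^ l"
    unfolding B_def using card_permute_list_eq'[OF snd_xs setw]
    by (simp add: lenw w count_ordered_dealing)
  have mem: "\<pi> \<in> dealt w ?D \<omega> \<longleftrightarrow> \<pi> permutes {..<?n} \<and> mset (zip ?D (permute_list \<pi> w)) = ?M" for \<pi>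
    using dealt_iff[of w ?D \<pi> \<omega>] count_hand_mset[OF \<omega>] lenD lenw
    by (auto intro!: multiset_eqI)
  have cardC: "card (C \<pi>) = (\<Prod>i\<in>{1..k}. \<Prod>j\<in>{1..l}. fact (\<omega> i j))" if "\<pi> \<in> dealt w ?D \<omega>" for \<pi>
  proof -
    have m: "mset (zip ?D (permute_list \<pi> w)) = ?M" and \<pi>: "\<pi> permutes {..<length w}"
      using that mem lenw by auto
    have "set (zip ?D (permute_list \<pi> w)) \<subseteq> {1..k} \<times> {1..l}"
      using set_ordered_deck setw set_permute_list[OF \<pi>]
      by (force dest: set_zip_leftD set_zip_rightD)
    then have "card (C \<pi>) = (\<Prod>x\<in>{1..k}\<times>{1..l}. fact (count ?M x))"
      using card_permute_list_eq'[of xs "zip ?D (permute_list \<pi> w)"] m xs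
      by (simp add: C_def lenD lenw)
    also have "\<dots> = (\<Prod>(i,j)\<in>{1..k}\<times>{1..l}. fact (\<omega> i j))"
      by (intro prod.cong refl) (auto simp: count_hand_mset[OF \<omega>])
    finally show ?thesis by (simp add: prod.cartesian_product)
  qed
  have "bij_betw (\<lambda>(\<alpha>, \<beta>). (\<beta> \<circ> inv \<alpha>, \<alpha>)) (A \<times> B) (Sigma (dealt w ?D \<omega>) C)"
  proof (rule bij_betwI[of _ _ _ "\<lambda>(\<pi>, \<alpha>). (\<alpha>, \<pi> \<circ> \<alpha>)"])
    show "(\<lambda>(\<alpha>, \<beta>). (\<beta> \<circ> inv \<alpha>, \<alpha>)) \<in> A \<times> B \<rightarrow> Sigma (dealt w ?D \<omega>) C"
    proof (clarsimp)
      fix \<alpha> \<beta> assume "\<alpha> \<in> A" "\<beta> \<in> B"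
      then have \<alpha>: "\<alpha> permutes {..<?n}" "permute_list \<alpha> ?D = map fst xs"
        and \<beta>: "\<beta> permutes {..<?n}" "permute_list \<beta> w = map snd xs" by (auto simp: A_def B_def)
      have \<pi>: "\<beta> \<circ> inv \<alpha> permutes {..<?n}"
        using \<alpha> \<beta> by (intro permutes_compose permutes_inv)
      have "permute_list \<alpha> (permute_list (\<beta> \<circ> inv \<alpha>) w) = permute_list (\<beta> \<circ> inv \<alpha> \<circ> \<alpha>) w"
        using \<alpha> lenw by (intro permute_list_compose[symmetric]) simp
      also have "\<beta> \<circ> inv \<alpha> \<circ> \<alpha> = \<beta>"
        using \<alpha>(1) by (simp add: fun_eq_iff permutes_inverses)
      also note \<beta>(2)
      finally have snd: "permute_list \<alpha> (permute_list (\<beta> \<circ> inv \<alpha>) w) = map snd xs" .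
      have "permute_list \<alpha> (zip ?D (permute_list (\<beta> \<circ> inv \<alpha>) w)) =
          zip (permute_list \<alpha> ?D) (permute_list \<alpha> (permute_list (\<beta> \<circ> inv \<alpha>) w))"
        by (rule permute_list_zip[OF \<alpha>(1)]) (simp_all add: lenD lenw)
      then have z: "permute_list \<alpha> (zip ?D (permute_list (\<beta> \<circ> inv \<alpha>) w)) = xs"
        unfolding \<alpha>(2) snd by (simp add: zip_map_fst_snd)
      then have "mset xs = mset (zip ?D (permute_list (\<beta> \<circ> inv \<alpha>) w))"
        using mset_permute_list[of \<alpha> "zip ?D (permute_list (\<beta> \<circ> inv \<alpha>) w)"] \<alpha>(1) lenD lenw by simp
      then show "\<beta> \<circ> inv \<alpha> \<in> dealt w ?D \<omega> \<and> \<alpha> \<in> C (\<beta> \<circ> inv \<alpha>)"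
        using mem \<pi> xs \<alpha>(1) z by (simp add: C_def)
    qed
    show "(\<lambda>(\<pi>, \<alpha>). (\<alpha>, \<pi> \<circ> \<alpha>)) \<in> Sigma (dealt w ?D \<omega>) C \<rightarrow> A \<times> B"
    proof (clarsimp)
      fix \<pi> \<alpha> assume "\<pi> \<in> dealt w ?D \<omega>" "\<alpha> \<in> C \<pi>"
      then have \<pi>: "\<pi> permutes {..<?n}" and \<alpha>: "\<alpha> permutes {..<?n}"
        and z: "permute_list \<alpha> (zip ?D (permute_list \<pi> w)) = xs" by (auto simp: mem C_def)
      have "zip (permute_list \<alpha> ?D) (permute_list \<alpha> (permute_list \<pi> w)) = xs"
        using z permute_list_zip[OF \<alpha>, of ?D "permute_list \<pi> w"] lenD lenw by simp
      then have "permute_list \<alpha> ?D = map fst xs" "permute_list \<alpha> (permute_list \<pi> w) = map snd xs"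
        using lenD lenw by auto
      then show "\<alpha> \<in> A \<and> \<pi> \<circ> \<alpha> \<in> B"
        using \<pi> \<alpha> lenw by (simp add: A_def B_def permutes_compose permute_list_compose)
    qed
  qed (auto simp: A_def C_def fun_eq_iff permutes_inverses)
  then have "card (A \<times> B) = card (Sigma (dealt w ?D \<omega>) C)" by (rule bij_betw_same_card)
  moreover have "finite (C \<pi>)" for \<pi>
    by (rule finite_subset[OF _ finite_permutations[of "{..<?n}"]]) (auto simp: C_def)
  ultimately have "card A * card B = (\<Sum>\<pi>\<in>dealt w ?D \<omega>. card (C \<pi>))"
    by (simp add: card_cartesian_product card_SigmaI)
  then show ?thesis by (simp add: cardA cardB cardC)
qed

lemma card_dealt_stationary:
  assumes "\<omega> \<in> hands s l k p" "mset w = mset (ordered_dealing s l)"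
    and "(\<Sum>i\<in>{1..k}. p i) = l * s"
  shows "real (card (dealt w (ordered_deck k p) \<omega>)) / fact (l * s) = stationary s l k p \<omega>"
proof -
  let ?P = "\<Prod>i\<in>{1..k}. \<Prod>j\<in>{1..l}. fact (\<omega> i j)"
  have "real (card (dealt w (ordered_deck k p) \<omega>) * ?P) = real ((\<Prod>i\<in>{1..k}. fact (p i)) * fact s ^ l)"
    using card_dealt[OF assms] by (rule arg_cong)
  then have "real (card (dealt w (ordered_deck k p) \<omega>)) * ?P = (\<Prod>i\<in>{1..k}. fact (p i)) * fact s ^ l"
    by (simp add: of_nat_prod)
  moreover have "?P \<noteq> (0 :: real)" by simp
  ultimately show ?thesis
    unfolding stationary_def prod_dividef by (simp add: field_simps)
qed

subsection \<open>Averaging over the positions of a player\<close>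

text \<open>
  For positions \<open>m\<close>, \<open>m'\<close> of two different classes of \<open>w\<close>, the number of permutations in \<open>T\<close> that
  send \<open>i\<close>, \<open>i'\<close> to \<open>m\<close>, \<open>m'\<close> depends only on the two classes; within one class the antisymmetry
  of \<open>g\<close> makes everything cancel.
\<close>

lemma sum_average_classes:
  fixes w :: "nat \<Rightarrow> 'a" and g :: "nat \<Rightarrow> nat \<Rightarrow> real"
  assumes fin: "finite T" and perm: "\<And>\<pi>. \<pi> \<in> T \<Longrightarrow> \<pi> permutes {..<n}"
    and closed: "\<And>\<pi> \<sigma>. \<pi> \<in> T \<Longrightarrow> \<sigma> permutes {..<n} \<Longrightarrow> (\<And>m. m < n \<Longrightarrow> w (\<sigma> m) = w m) \<Longrightarrow> \<sigma> \<circ> \<pi> \<in> T"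
    and i: "i < n" "i' < n" "i \<noteq> i'"
    and g: "\<And>m m'. g m m' = - g m' m"
    and fibre: "\<And>m. m < n \<Longrightarrow> card {m'. m' < n \<and> w m' = w m} = s"
  shows "real s ^ 2 * (\<Sum>\<pi>\<in>T. g (\<pi> i) (\<pi> i')) =
    (\<Sum>\<pi>\<in>T. \<Sum>m | m < n \<and> w m = w (\<pi> i). \<Sum>m' | m' < n \<and> w m' = w (\<pi> i'). g m m')"
proof -
  define F where "F j = {m. m < n \<and> w m = j}" for j
  define A where "A j j' = (\<Sum>m\<in>F j. \<Sum>m'\<in>F j'. g m m')" for j j'
  define U where "U j j' = {\<pi> \<in> T. w (\<pi> i) = j \<and> w (\<pi> i') = j'}" for j j'
  let ?J = "w ` {..<n}"
  have finF [simp]: "finite (F j)" for j by (simp add: F_def)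
  have finU [simp]: "finite (U j j')" for j j' using fin by (simp add: U_def)
  have cardF: "card (F j) = s" if "j \<in> ?J" for j
    using that fibre by (auto simp: F_def)
  have in_n: "\<pi> i < n" "\<pi> i' < n" if "\<pi> \<in> T" for \<pi>
    using permutes_in_image[OF perm[OF that]] i by auto
  have swap_in: "transpose x y \<circ> \<pi> \<in> T" if "\<pi> \<in> T" "x < n" "y < n" "w x = w y" for \<pi> x y
    using that by (intro closed permutes_swap_id) (auto simp: transpose_def)
  have ne: "\<pi> i \<noteq> \<pi> i'" if "\<pi> \<in> T" for \<pi>
    using permutes_inj[OF perm[OF that]] i by (auto dest: injD)
  \<comment> \<open>The claim is proved separately for each pair of classes that the two images may
    lie in.\<close>
  have key: "real s ^ 2 * (\<Sum>\<pi>\<in>U j j'. g (\<pi> i) (\<pi> i')) = (\<Sum>\<pi>\<in>U j j'. A j j')"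
    if J: "j \<in> ?J" "j' \<in> ?J" for j j'
  proof (cases "j = j'")
    case True
    have "A j j = (\<Sum>m'\<in>F j. \<Sum>m\<in>F j. g m m')" unfolding A_def by (rule sum.swap)
    also have "\<dots> = - A j j" unfolding A_def by (subst g) (simp add: sum_negf)
    finally have A0: "A j j = 0" by simp
    \<comment> \<open>Exchanging the two images stays inside \<open>U j j\<close> and reverses the
      sign of \<open>g\<close>, so this sum vanishes as well as \<open>A j j\<close>.\<close>
    have swap_U: "transpose (\<pi> i) (\<pi> i') \<circ> \<pi> \<in> U j j" if "\<pi> \<in> U j j" for \<pi>
      using that in_n[of \<pi>] by (auto simp: U_def intro: swap_in)
    have "(\<Sum>\<pi>\<in>U j j. g (\<pi> i) (\<pi> i')) = (\<Sum>\<pi>\<in>U j j. g (\<pi> i') (\<pi> i))"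
      by (rule sum.reindex_bij_witness[of _ "\<lambda>\<pi>. transpose (\<pi> i) (\<pi> i') \<circ> \<pi>" "\<lambda>\<pi>. transpose (\<pi> i) (\<pi> i') \<circ> \<pi>"])
         (simp_all add: swap_U, simp_all add: fun_eq_iff transpose_commute)
    also have "\<dots> = - (\<Sum>\<pi>\<in>U j j. g (\<pi> i) (\<pi> i'))" by (subst g) (simp add: sum_negf)
    finally have "(\<Sum>\<pi>\<in>U j j. g (\<pi> i) (\<pi> i')) = 0" by simp
    with True A0 show ?thesis by simp
  next
    case False
    define R where "R m m' = {\<pi> \<in> U j j'. \<pi> i = m \<and> \<pi> i' = m'}" for m m'
    \<comment> \<open>For distinct classes, two transpositions, each within one class, move the
      prescribed images independently; hence all \<open>R m m'\<close> are equally large.\<close>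
    have le: "card (R m m') \<le> card (R x x')" if m: "m \<in> F j" "m' \<in> F j'" "x \<in> F j" "x' \<in> F j'" for m m' x x'
    proof (rule card_inj_on_le)
      let ?f = "\<lambda>\<pi>. transpose m x \<circ> (transpose m' x' \<circ> \<pi>)"
      show "inj_on ?f (R m m')"
        by (rule inj_onI) (metis comp_assoc id_comp transpose_comp_involutory)
      have "m \<noteq> m'" "m \<noteq> x'" "x \<noteq> m'" "x \<noteq> x'" using m False by (auto simp: F_def)
      then show "?f ` R m m' \<subseteq> R x x'"
        using m by (auto simp: R_def U_def F_def intro!: swap_in)
      show "finite (R x x')" by (simp add: R_def)
    qed
    have "\<exists>r. \<forall>m\<in>F j. \<forall>m'\<in>F j'. card (R m m') = r"
    proof (cases "\<exists>m m'. m \<in> F j \<and> m' \<in> F j'")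
      case True
      then obtain m m' where "m \<in> F j" "m' \<in> F j'" by blast
      then show ?thesis using le by (intro exI[of _ "card (R m m')"]) (auto intro: antisym)
    qed blast
    then obtain r where r: "card (R m m') = r" if "m \<in> F j" "m' \<in> F j'" for m m' by blast
    have group: "(\<Sum>\<pi>\<in>U j j'. h (\<pi> i) (\<pi> i')) = real r * (\<Sum>m\<in>F j. \<Sum>m'\<in>F j'. h m m')"
      for h :: "nat \<Rightarrow> nat \<Rightarrow> real"
    proof -
      have "(\<Sum>\<pi>\<in>U j j'. h (\<pi> i) (\<pi> i')) =
          (\<Sum>x\<in>F j \<times> F j'. \<Sum>\<pi> | \<pi> \<in> U j j' \<and> (\<pi> i, \<pi> i') = x. h (\<pi> i) (\<pi> i'))"
        using in_n fin by (intro sum.group[symmetric]) (auto simp: U_def F_def)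
      also have "\<dots> = (\<Sum>(m, m')\<in>F j \<times> F j'. real r * h m m')"
      proof (intro sum.cong refl, clarify)
        fix m m' assume m: "m \<in> F j" "m' \<in> F j'"
        have "(\<Sum>\<pi> | \<pi> \<in> U j j' \<and> (\<pi> i, \<pi> i') = (m, m'). h (\<pi> i) (\<pi> i')) = (\<Sum>\<pi>\<in>R m m'. h m m')"
          by (intro sum.cong) (auto simp: R_def)
        then show "(\<Sum>\<pi> | \<pi> \<in> U j j' \<and> (\<pi> i, \<pi> i') = (m, m'). h (\<pi> i) (\<pi> i')) = real r * h m m'"
          by (simp add: r[OF m])
      qed
      finally show ?thesis by (simp add: sum.cartesian_product sum_distrib_left case_prod_unfold)
    qed
    show ?thesis
      \<comment> \<open>The constant function gives
        \<open>card (U j j') * A j j' = r * s^2 * A j j'\<close>, to be compared with the value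
        \<open>r * A j j'\<close> for \<open>g\<close>.\<close>
      using group[of g] group[of "\<lambda>_ _. A j j'"] cardF[OF J(1)] cardF[OF J(2)]
      by (auto simp: A_def power2_eq_square mult_ac)
  qed
  have split: "(\<Sum>\<pi>\<in>T. h \<pi>) = (\<Sum>x\<in>?J \<times> ?J. \<Sum>\<pi>\<in>U (fst x) (snd x). h \<pi>)" for h :: "_ \<Rightarrow> real"
  proof -
    have "(\<Sum>\<pi>\<in>T. h \<pi>) = (\<Sum>x\<in>?J \<times> ?J. \<Sum>\<pi> | \<pi> \<in> T \<and> (w (\<pi> i), w (\<pi> i')) = x. h \<pi>)"
      using fin in_n by (intro sum.group[symmetric]) auto
    then show ?thesis by (simp add: U_def prod_eq_iff)
  qed
  have "real s ^ 2 * (\<Sum>\<pi>\<in>T. g (\<pi> i) (\<pi> i')) =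
      (\<Sum>x\<in>?J \<times> ?J. real s ^ 2 * (\<Sum>\<pi>\<in>U (fst x) (snd x). g (\<pi> i) (\<pi> i')))"
    by (simp add: split sum_distrib_left)
  also have "\<dots> = (\<Sum>x\<in>?J \<times> ?J. \<Sum>\<pi>\<in>U (fst x) (snd x). A (fst x) (snd x))"
    by (intro sum.cong refl key) auto
  also have "\<dots> = (\<Sum>x\<in>?J \<times> ?J. \<Sum>\<pi>\<in>U (fst x) (snd x). A (w (\<pi> i)) (w (\<pi> i')))"
    by (intro sum.cong refl) (simp add: U_def)
  also have "\<dots> = (\<Sum>\<pi>\<in>T. A (w (\<pi> i)) (w (\<pi> i')))" by (rule split[symmetric])
  finally show ?thesis by (simp only: A_def F_def)
qed

subsection \<open>The balance of a dealing word\<close>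

definition positions :: "nat list \<Rightarrow> nat \<Rightarrow> nat set" where
  "positions w j = {m. m < length w \<and> w ! m = j}"

text \<open>
  For players \<open>j\<close>, \<open>j'\<close> this equals \<open>t * sgn (j' - j)\<close> with \<open>t = s\<^sup>2\<close> for ordered and \<open>t = s\<close> for cyclic dealing, while for back and
  forth dealing consecutive blocks cancel and \<open>t\<close> is the parity of \<open>s\<close>.
\<close>

definition balance :: "nat list \<Rightarrow> nat \<Rightarrow> nat \<Rightarrow> real" where
  "balance w j j' = (\<Sum>m\<in>positions w j. \<Sum>m'\<in>positions w j'. sgn (real m' - real m))"

lemma finite_positions [simp]: "finite (positions w j)"
  by (simp add: positions_def)

lemma card_positions: "card (positions w j) = count_list w j"
  using count_mset_card[of w j] by (simp add: positions_def count_mset)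

lemma positions_Cons:
  "positions (x # w) j = (if x = j then insert 0 (Suc ` positions w j) else Suc ` positions w j)"
proof (rule set_eqI)
  fix m
  show "m \<in> positions (x # w) j \<longleftrightarrow>
      m \<in> (if x = j then insert 0 (Suc ` positions w j) else Suc ` positions w j)"
    by (cases m) (auto simp: positions_def)
qed

lemma balance_Nil: "balance [] j j' = 0"
  by (simp add: balance_def positions_def)

text \<open>The new letter precedes all others, so it counts +1 or -1 against each of them; if
  \<open>j = j'\<close> the two corrections cancel.\<close>

lemma balance_Cons:
  "balance (x # w) j j' = balance w j j' +
     (if x = j then real (count_list w j') else 0) - (if x = j' then real (count_list w j) else 0)"
proof -
  have *: "(\<Sum>m\<in>positions (x # w) j. h m) = (if x = j then h 0 else 0) + (\<Sum>m\<in>positions w j. h (Suc m))"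
    for h :: "nat \<Rightarrow> real" and j
    by (simp add: positions_Cons sum.reindex)
  show ?thesis
    unfolding balance_def * by (simp add: sum.distrib card_positions sum_negf sum_subtractf)
qed

lemma balance_append:
  "balance (u @ v) j j' = balance u j j' + balance v j j' +
     real (count_list u j) * real (count_list v j') - real (count_list v j) * real (count_list u j')"
  by (induction u) (auto simp: balance_Nil balance_Cons algebra_simps)

lemma balance_rev: "balance (rev w) j j' = - balance w j j'"
  by (induction w) (auto simp: balance_Nil balance_Cons balance_append)

lemma balance_replicate: "balance (replicate m x) j j' = 0"
  by (induction m) (auto simp: balance_Nil balance_Cons)

text \<open>When every block contains both players once, the cross terms between two blocks
  cancel.\<close>

lemma balance_concat:
  assumes "\<And>u. u \<in> set us \<Longrightarrow> count_list u j = 1" "\<And>u. u \<in> set us \<Longrightarrow> count_list u j' = 1"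
  shows "balance (concat us) j j' = (\<Sum>u\<leftarrow>us. balance u j j')"
proof -
  have len: "count_list (concat us) i = length us" if "\<And>u. u \<in> set us \<Longrightarrow> count_list u i = 1" for us :: "nat list list" and i
    using that by (induction us) auto
  show ?thesis using assms
    by (induction us) (auto simp: balance_Nil balance_append len)
qed

lemma count_list_ordered_dealing: "count_list (ordered_dealing s l) j = (if j \<in> {1..l} then s else 0)"
  using count_ordered_dealing[of s l j] by (simp add: count_mset)

lemma balance_ordered_dealing:
  "balance (ordered_dealing s l) j j' =
     (if j \<in> {1..l} \<and> j' \<in> {1..l} then real s ^ 2 * sgn (real j' - real j) else 0)"
proof (induction l)
  case 0
  show ?case by (simp add: ordered_dealing_def balance_Nil)
next
  case (Suc l)
  have o: "ordered_dealing s (Suc l) = ordered_dealing s l @ replicate s (Suc l)"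
    by (simp add: ordered_dealing_def)
  have c: "count_list (replicate s x) i = (if x = i then s else 0)" for x i :: nat
    by (induction s) auto
  show ?case
    unfolding o balance_append Suc balance_replicate count_list_ordered_dealing c
    by (auto simp: power2_eq_square)
qed

text \<open>A single block is ordered dealing of one card each, so its counts and balance come from
  the ordered case.\<close>

lemma upt_eq_ordered_dealing: "[1..<Suc l] = ordered_dealing 1 l"
  by (simp add: ordered_dealing_def del: upt_Suc)

lemma balance_cyclic_dealing:
  assumes "j \<in> {1..l}" "j' \<in> {1..l}"
  shows "balance (cyclic_dealing s l) j j' = real s * sgn (real j' - real j)"
  unfolding cyclic_dealing_def upt_eq_ordered_dealing using assms
  by (subst balance_concat)
     (auto simp: count_list_ordered_dealing balance_ordered_dealing sum_list_replicate)

lemma balance_back_forth_dealing: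
  assumes "j \<in> {1..l}" "j' \<in> {1..l}"
  shows "balance (back_forth_dealing s l) j j' = of_bool (odd s) * sgn (real j' - real j)"
proof -
  \<comment> \<open>Forward and reversed blocks have opposite balances; for odd \<open>s\<close> one
    forward block is left over.\<close>
  have "(\<Sum>b\<leftarrow>[0..<s]. if even b then x else - x) = of_bool (odd s) * x" for x :: real
    by (induction s) auto
  moreover have "balance (if even b then u else rev u) j j' =
      (if even b then balance u j j' else - balance u j j')" for b :: nat and u
    by (simp add: balance_rev)
  ultimately show ?thesis
    unfolding back_forth_dealing_def upt_eq_ordered_dealing using assms
    by (subst balance_concat)
       (auto simp: count_list_ordered_dealing balance_ordered_dealing comp_def)
qed

lemma count_list_concat_map:
  assumes "\<And>b. b \<in> set bs \<Longrightarrow> count_list (f b) j = c"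
  shows "count_list (concat (map f bs)) j = length bs * c"
  using assms by (induction bs) auto

lemma mset_cyclic_dealing: "mset (cyclic_dealing s l) = mset (ordered_dealing s l)"
proof (rule multiset_eqI, unfold count_mset)
  fix j
  have "count_list (cyclic_dealing s l) j = s * count_list (ordered_dealing 1 l) j"
    using count_list_concat_map[of "[0..<s]" "\<lambda>_. ordered_dealing 1 l" j "count_list (ordered_dealing 1 l) j"]
    by (simp only: cyclic_dealing_def upt_eq_ordered_dealing map_replicate_const length_upt diff_zero)
  then show "count_list (cyclic_dealing s l) j = count_list (ordered_dealing s l) j"
    by (simp add: count_list_ordered_dealing)
qed

lemma mset_back_forth_dealing: "mset (back_forth_dealing s l) = mset (ordered_dealing s l)"
proof (rule multiset_eqI, unfold count_mset)
  fix j
  have "count_list (back_forth_dealing s l) j = s * count_list (ordered_dealing 1 l) j"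
    unfolding back_forth_dealing_def upt_eq_ordered_dealing
    by (subst count_list_concat_map[where c = "count_list (ordered_dealing 1 l) j"]) auto
  then show "count_list (back_forth_dealing s l) j = count_list (ordered_dealing s l) j"
    by (simp add: count_list_ordered_dealing)
qed

subsection \<open>The hand probabilities up to first order\<close>

text \<open>
  All dealing words are rearrangements of each other, so the ordered one can serve as a reference;
  the coefficient of \<open>1 / a\<close> for a word of balance \<open>t * sgn (j' - j)\<close> is \<open>t\<close> times this quantity.
\<close>

definition hand_drift :: "nat \<Rightarrow> nat \<Rightarrow> nat \<Rightarrow> (nat \<Rightarrow> nat) \<Rightarrow> (nat \<Rightarrow> nat \<Rightarrow> nat) \<Rightarrow> real" where
  "hand_drift s l k p \<omega> = 1 / (2 * fact (l * s - 1) * real s ^ 2) *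
     (\<Sum>i<l * s - 1. \<Sum>\<pi>\<in>dealt (ordered_dealing s l) (ordered_deck k p) \<omega>.
        sgn (real (ordered_dealing s l ! \<pi> (Suc i)) - real (ordered_dealing s l ! \<pi> i)))"

text \<open>The map \<open>\<pi> \<mapsto> \<tau> \<circ> \<pi>\<close> takes shuffles for the
  rearranged word to shuffles for \<open>w\<close> and preserves which player receives each card.
  Sums over receivers therefore depend only on the letters of the word.\<close>

lemma sum_dealt_permute_list:
  assumes \<tau>: "\<tau> permutes {..<length D}" and len: "length w = length D"
    and i: "i < length D" "i' < length D"
  shows "(\<Sum>\<pi>\<in>dealt (permute_list \<tau> w) D \<omega>. h (permute_list \<tau> w ! \<pi> i) (permute_list \<tau> w ! \<pi> i')) =
    (\<Sum>\<pi>\<in>dealt w D \<omega>. h (w ! \<pi> i) (w ! \<pi> i') :: real)"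
proof -
  have nth: "permute_list \<tau> w ! \<pi> m = w ! \<tau> (\<pi> m)" if "\<pi> permutes {..<length D}" "m < length D" for \<pi> m
    using \<tau> len that permutes_in_image[OF that(1), of m] by (simp add: permute_list_nth)
  note inv = permutes_inv[OF \<tau>]
  have deal: "\<pi> \<in> dealt (permute_list \<tau> w) D \<omega> \<longleftrightarrow> \<tau> \<circ> \<pi> \<in> dealt w D \<omega>" if "\<pi> permutes {..<length D}" for \<pi>
    using that permutes_compose[OF that \<tau>] by (simp add: dealt_def nth[OF that] cong: conj_cong)
  show ?thesis
  proof (rule sum.reindex_bij_witness[of _ "\<lambda>\<pi>. inv \<tau> \<circ> \<pi>" "\<lambda>\<pi>. \<tau> \<circ> \<pi>"])
    fix \<pi> assume \<pi>: "\<pi> \<in> dealt (permute_list \<tau> w) D \<omega>"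
    then have p: "\<pi> permutes {..<length D}" by (simp add: dealt_def)
    show "\<tau> \<circ> \<pi> \<in> dealt w D \<omega>" using deal[OF p] \<pi> by simp
    show "inv \<tau> \<circ> (\<tau> \<circ> \<pi>) = \<pi>" by (simp add: fun_eq_iff permutes_inverses[OF \<tau>])
    show "h (w ! (\<tau> \<circ> \<pi>) i) (w ! (\<tau> \<circ> \<pi>) i') = h (permute_list \<tau> w ! \<pi> i) (permute_list \<tau> w ! \<pi> i')"
      by (simp add: nth[OF p] i)
  next
    fix \<pi> assume \<pi>: "\<pi> \<in> dealt w D \<omega>"
    then have "inv \<tau> \<circ> \<pi> permutes {..<length D}"
      using inv by (auto simp: dealt_def intro: permutes_compose)
    moreover show "\<tau> \<circ> (inv \<tau> \<circ> \<pi>) = \<pi>" by (simp add: fun_eq_iff permutes_inverses[OF \<tau>])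
    ultimately show "inv \<tau> \<circ> \<pi> \<in> dealt (permute_list \<tau> w) D \<omega>" using deal \<pi> by simp
  qed
qed

text \<open>Averaging replaces signs of positions by balances, that is by \<open>t\<close> times
  signs of players; the remaining sum is independent of the order of the word.\<close>

lemma sum_sgn_dealt:
  assumes w: "mset w = mset (ordered_dealing s l)" and len: "length D = l * s"
    and bal: "\<And>j j'. j \<in> {1..l} \<Longrightarrow> j' \<in> {1..l} \<Longrightarrow> balance w j j' = t * sgn (real j' - real j)"
    and i: "Suc i < l * s"
  shows "real s ^ 2 * (\<Sum>\<pi>\<in>dealt w D \<omega>. sgn (real (\<pi> (Suc i)) - real (\<pi> i))) =
    t * (\<Sum>\<pi>\<in>dealt (ordered_dealing s l) D \<omega>.
        sgn (real (ordered_dealing s l ! \<pi> (Suc i)) - real (ordered_dealing s l ! \<pi> i)))"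
proof -
  have lenw: "length w = l * s" using w length_ordered_dealing mset_eq_length by metis
  have setw: "set w \<subseteq> {1..l}" using w set_ordered_dealing mset_eq_setD by metis
  have nth: "w ! m \<in> {1..l}" if "m < l * s" for m using subsetD[OF setw nth_mem] lenw that by simp
  have "real s ^ 2 * (\<Sum>\<pi>\<in>dealt w D \<omega>. sgn (real (\<pi> (Suc i)) - real (\<pi> i))) =
    (\<Sum>\<pi>\<in>dealt w D \<omega>. \<Sum>m | m < l * s \<and> w ! m = w ! \<pi> i. \<Sum>m' | m' < l * s \<and> w ! m' = w ! \<pi> (Suc i).
       sgn (real m' - real m))"
  proof (rule sum_average_classes)
    fix \<pi> assume "\<pi> \<in> dealt w D \<omega>"
    then show p: "\<pi> permutes {..<l * s}" by (simp add: dealt_def len)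
    fix \<sigma> assume \<sigma>: "\<sigma> permutes {..<l * s}" "\<And>m. m < l * s \<Longrightarrow> w ! \<sigma> m = w ! m"
    have "w ! \<sigma> (\<pi> m) = w ! \<pi> m" if "m < l * s" for m
      using \<sigma>(2) permutes_in_image[OF p, of m] that by simp
    then show "\<sigma> \<circ> \<pi> \<in> dealt w D \<omega>"
      using \<open>\<pi> \<in> dealt w D \<omega>\<close> permutes_compose[OF p \<sigma>(1)]
      by (simp add: dealt_def len cong: conj_cong)
  next
    fix m assume "m < l * s"
    then have "w ! m \<in> {1..l}" by (rule nth)
    then have "count (mset w) (w ! m) = s" by (simp add: w count_ordered_dealing)
    then show "card {m'. m' < l * s \<and> w ! m' = w ! m} = s" by (simp add: count_mset_card lenw)
  next
    show "sgn (real m' - real m) = - sgn (real m - real m')" for m m' :: nat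
      by (simp add: sgn_if)
  qed (use i in auto)
  also have "\<dots> = (\<Sum>\<pi>\<in>dealt w D \<omega>. balance w (w ! \<pi> i) (w ! \<pi> (Suc i)))"
    by (simp add: balance_def positions_def lenw)
  also have "\<dots> = (\<Sum>\<pi>\<in>dealt w D \<omega>. t * sgn (real (w ! \<pi> (Suc i)) - real (w ! \<pi> i)))"
  proof (intro sum.cong refl bal nth)
    fix \<pi> assume "\<pi> \<in> dealt w D \<omega>"
    then have p: "\<pi> permutes {..<l * s}" by (simp add: dealt_def len)
    show "\<pi> i < l * s" "\<pi> (Suc i) < l * s" using permutes_in_image[OF p] i by auto
  qed
  also have "\<dots> = t * (\<Sum>\<pi>\<in>dealt w D \<omega>. sgn (real (w ! \<pi> (Suc i)) - real (w ! \<pi> i)))"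
    by (simp add: sum_distrib_left)
  also obtain \<tau> where \<tau>: "\<tau> permutes {..<length (ordered_dealing s l)}" "permute_list \<tau> (ordered_dealing s l) = w"
    using w by (rule mset_eq_permutation)
  then have "(\<Sum>\<pi>\<in>dealt w D \<omega>. sgn (real (w ! \<pi> (Suc i)) - real (w ! \<pi> i))) =
    (\<Sum>\<pi>\<in>dealt (ordered_dealing s l) D \<omega>.
        sgn (real (ordered_dealing s l ! \<pi> (Suc i)) - real (ordered_dealing s l ! \<pi> i)))"
    using sum_dealt_permute_list[where \<tau> = \<tau> and D = D and w = "ordered_dealing s l" and i = "Suc i" and i' = i
          and \<omega> = \<omega> and h = "\<lambda>x y. sgn (real x - real y)"]
      len i by (simp add: length_ordered_dealing)
  finally show ?thesis .
qed

lemma first_order_hand_prob: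
  assumes w: "mset w = mset (ordered_dealing s l)" and s: "s \<ge> 1" and l: "l \<ge> 1"
    and len: "(\<Sum>i\<in>{1..k}. p i) = l * s"
    and bal: "\<And>j j'. j \<in> {1..l} \<Longrightarrow> j' \<in> {1..l} \<Longrightarrow> balance w j j' = t * sgn (real j' - real j)"
    and \<omega>: "\<omega> \<in> hands s l k p"
  shows "first_order (\<lambda>a. hand_prob w k p a \<omega>) (stationary s l k p \<omega>) (t * hand_drift s l k p \<omega>)"
proof -
  let ?D = "ordered_deck k p"
  let ?T = "dealt w ?D \<omega>"
  let ?n = "l * s"
  have n: "?n \<ge> 1" using s l by simp
  have lenD: "length ?D = ?n" using len by (simp add: length_ordered_deck)
  have "first_order (\<lambda>a. \<Sum>\<pi>\<in>?T. shuffle_prob a ?n \<pi>) (\<Sum>\<pi>\<in>?T. 1 / fact ?n)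
    (\<Sum>\<pi>\<in>?T. 1 / (2 * fact (?n - 1)) * (\<Sum>i<?n-1. sgn (real (\<pi> (Suc i)) - real (\<pi> i))))"
    by (intro first_order_sum first_order_shuffle_prob n) (simp add: dealt_def lenD)
  moreover have "(\<Sum>\<pi>\<in>?T. 1 / fact ?n) = stationary s l k p \<omega>"
    using card_dealt_stationary[OF \<omega> w len] by simp
  moreover have "(\<Sum>\<pi>\<in>?T. 1 / (2 * fact (?n - 1)) * (\<Sum>i<?n-1. sgn (real (\<pi> (Suc i)) - real (\<pi> i)))) =
    t * hand_drift s l k p \<omega>"
  proof -
    have "(\<Sum>\<pi>\<in>?T. 1 / (2 * fact (?n - 1)) * (\<Sum>i<?n-1. sgn (real (\<pi> (Suc i)) - real (\<pi> i)))) =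
      1 / (2 * fact (?n - 1)) * (\<Sum>i<?n-1. \<Sum>\<pi>\<in>?T. sgn (real (\<pi> (Suc i)) - real (\<pi> i)))"
      by (subst sum.swap) (simp add: sum_distrib_left)
    \<comment> \<open>The factor \<open>s^2\<close> is inserted to match
      \<open>sum_sgn_dealt\<close>.\<close>
    also have "\<dots> = 1 / (2 * fact (?n - 1) * real s ^ 2) *
        (\<Sum>i<?n-1. real s ^ 2 * (\<Sum>\<pi>\<in>?T. sgn (real (\<pi> (Suc i)) - real (\<pi> i))))"
      using s by (simp flip: sum_distrib_left)
    also have "(\<Sum>i<?n-1. real s ^ 2 * (\<Sum>\<pi>\<in>?T. sgn (real (\<pi> (Suc i)) - real (\<pi> i)))) =
        (\<Sum>i<?n-1. t * (\<Sum>\<pi>\<in>dealt (ordered_dealing s l) ?D \<omega>.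
        sgn (real (ordered_dealing s l ! \<pi> (Suc i)) - real (ordered_dealing s l ! \<pi> i))))"
      by (intro sum.cong refl sum_sgn_dealt[OF w lenD bal]) auto
    finally show ?thesis by (simp add: hand_drift_def flip: sum_distrib_left)
  qed
  ultimately show ?thesis by (simp add: hand_prob_eq lenD)
qed

text \<open>By the reverse triangle inequality, taking absolute values does not enlarge the error,
  whatever the sign of \<open>d\<close> and even for \<open>d = 0\<close>.\<close>

lemma first_order_abs_diff:
  assumes "first_order f c d"
  shows "first_order (\<lambda>a. \<bar>f a - c\<bar>) 0 \<bar>d\<bar>"
proof -
  have "norm (\<bar>f a - c\<bar> - 0 - \<bar>d\<bar> * (1 / real a)) \<le> norm (f a - c - d * (1 / real a))" for a
  proof -
    have "\<bar>d\<bar> * (1 / real a) = \<bar>d * (1 / real a)\<bar>" by (simp add: abs_mult)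
    then show ?thesis by (simp only: diff_0_right real_norm_def abs_triangle_ineq3)
  qed
  then have "(\<lambda>a. \<bar>f a - c\<bar> - 0 - \<bar>d\<bar> * (1 / real a)) \<in> O(\<lambda>a. f a - c - d * (1 / real a))"
    by (intro landau_o.big_mono always_eventually allI)
  then show ?thesis using assms unfolding first_order_def by (rule landau_o.big_trans)
qed

lemma variation_distance_coeff:
  assumes w: "mset w = mset (ordered_dealing s l)" and s: "s \<ge> 1" and l: "l \<ge> 1"
    and len: "(\<Sum>i\<in>{1..k}. p i) = l * s" and t: "t \<ge> 0"
    and bal: "\<And>j j'. j \<in> {1..l} \<Longrightarrow> j' \<in> {1..l} \<Longrightarrow> balance w j j' = t * sgn (real j' - real j)"
  shows "has_inv_coeff (variation_distance w s l k p)
    (t * (1 / 2 * (\<Sum>\<omega>\<in>hands s l k p. \<bar>hand_drift s l k p \<omega>\<bar>)))"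
proof -
  have "first_order (variation_distance w s l k p) (1 / 2 * (\<Sum>\<omega>\<in>hands s l k p. 0))
    (1 / 2 * (\<Sum>\<omega>\<in>hands s l k p. \<bar>t * hand_drift s l k p \<omega>\<bar>))"
    unfolding variation_distance_def
    by (intro first_order_cmult first_order_sum first_order_abs_diff first_order_hand_prob
        w s l len bal)
  then show ?thesis
    using t by (simp add: first_order_def has_inv_coeff_def abs_mult sum_distrib_left mult_ac)
qed

theorem theorem4p1:
  fixes s l k :: nat and p :: "nat \<Rightarrow> nat"
  assumes "s \<ge> 1" and "l \<ge> 1" and "k \<ge> 1"
    and "\<And>i. i \<in> {1..k} \<Longrightarrow> p i \<ge> 1"
    and "(\<Sum>i\<in>{1..k}. p i) = l * s"
  shows "\<exists>\<kappa>_ord \<kappa>_cyc \<kappa>_bf.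
           has_inv_coeff (variation_distance (ordered_dealing s l) s l k p) \<kappa>_ord \<and>
           has_inv_coeff (variation_distance (cyclic_dealing s l) s l k p) \<kappa>_cyc \<and>
           has_inv_coeff (variation_distance (back_forth_dealing s l) s l k p) \<kappa>_bf \<and>
           \<kappa>_ord = real s * \<kappa>_cyc \<and>
           (even s \<longrightarrow> \<kappa>_bf = 0) \<and>
           (odd s \<longrightarrow> \<kappa>_bf = 1 / real s * \<kappa>_cyc)"
proof -
  \<comment> \<open>\<open>K\<close> is common to the three methods; the coefficients are
    \<open>t * K\<close> with \<open>t\<close> equal to \<open>s^2\<close>, \<open>s\<close> and the
    parity of \<open>s\<close>.\<close>
  define K where "K = 1 / 2 * (\<Sum>\<omega>\<in>hands s l k p. \<bar>hand_drift s l k p \<omega>\<bar>)"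
  note coeff = variation_distance_coeff[OF _ assms(1,2,5), folded K_def]
  show ?thesis
  proof (intro exI conjI)
    show "has_inv_coeff (variation_distance (ordered_dealing s l) s l k p) (real s ^ 2 * K)"
      by (rule coeff) (simp_all add: balance_ordered_dealing)
    show "has_inv_coeff (variation_distance (cyclic_dealing s l) s l k p) (real s * K)"
      by (rule coeff) (simp_all add: mset_cyclic_dealing balance_cyclic_dealing)
    show "has_inv_coeff (variation_distance (back_forth_dealing s l) s l k p) (of_bool (odd s) * K)"
      by (rule coeff) (simp_all add: mset_back_forth_dealing balance_back_forth_dealing)
  qed (use assms(1) in \<open>simp_all add: power2_eq_square\<close>)
qed

end
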